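(* Consider black-peg Mastermind with $n$ positions and $k=k(n)$ colors. The following hold, where all $O$-, $\Omega$- and $o$-notation refers to $n\to\infty$ and hides only absolute constants. (i) If $k=\Omega(n)$, then there exists a randomized Codebreaker strategy that uses only black-peg answers and such that, for every secret code $z\in[k]^n$, the expected number of guesses until Codebreaker guesses $z$ is $O(n\log\log n + k)$. (ii) If $k=o(n)$, then there exists a randomized Codebreaker strategy that uses only black-peg answers and such that, for every secret code $z\in[k]^n$, the expected number of guesses until Codebreaker guesses $z$ is $O\!\left(n\log\!\left(\frac{\log n}{\log(n/k)}\right)\right)$.
   Context: Mastermind with $n$ positions and $k$ colors: write $[k]=\{1,\dots,k\}$. Codemaker fixes a secret code $z\in[k]^n$. In each round Codebreaker guesses a string $x\in[k]^n$ (possibly depending on all previous answers and on his own randomness). In black-peg Mastermind Codemaker answers only with $\mathrm{eq}(z,x)=|\{i\in[n]: z_i=x_i\}|$. Codebreaker wins when he guesses $z$. $\log$ denotes the binary logarithm.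
   Formalization: In (ii) it is additionally assumed that k(n) ≥ 2 for all sufficiently large n; for k = 1 the stated bound equals n·log(log n / log n) = 0 although one guess is always needed, so the claim fails there. *)

theory Defs
  imports "HOL-Probability.Probability" "HOL-Library.Landau_Symbols"
begin

definition codes :: "nat \<Rightarrow> nat \<Rightarrow> (nat \<Rightarrow> nat) set" where
  "codes n k = {1..n} \<rightarrow>\<^sub>E {1..k}"

definition eq_pegs :: "nat \<Rightarrow> (nat \<Rightarrow> nat) \<Rightarrow> (nat \<Rightarrow> nat) \<Rightarrow> nat" where
  "eq_pegs n z x = card {i \<in> {1..n}. z i = x i}"

text \<open>
  A deterministic strategy maps the list of all answers so far (oldest first) to the
  next guess. Codebreaker's own earlier guesses are determined by these answers.
\<close>

type_synonym det_strategy = "nat list \<Rightarrow> nat \<Rightarrow> nat"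

primrec answers :: "nat \<Rightarrow> det_strategy \<Rightarrow> (nat \<Rightarrow> nat) \<Rightarrow> nat \<Rightarrow> nat list" where
  "answers n s z 0 = []"
| "answers n s z (Suc t) = answers n s z t @ [eq_pegs n z (s (answers n s z t))]"

definition guess :: "nat \<Rightarrow> det_strategy \<Rightarrow> (nat \<Rightarrow> nat) \<Rightarrow> nat \<Rightarrow> (nat \<Rightarrow> nat)" where
  "guess n s z t = s (answers n s z t)"

text \<open>
  The winning guess is counted. The value is \<open>\<infinity>\<close> if the code is never guessed. Play is
  continued after a win only formally; this does not affect the value.
\<close>

definition num_guesses :: "nat \<Rightarrow> det_strategy \<Rightarrow> (nat \<Rightarrow> nat) \<Rightarrow> enat" where
  "num_guesses n s z = (INF t\<in>{t. guess n s z t = z}. enat (Suc t))"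

text \<open>
  A randomized strategy is a probability distribution on deterministic strategies:
  Codebreaker's random choices are collected in one draw of \<open>s\<close>. Every strategy driven by
  an arbitrary source of randomness induces such a distribution. Measurability into
  \<open>count_space (codes n k)\<close> includes that all guesses are in \<open>codes n k\<close>.
\<close>

definition randomized_strategy :: "nat \<Rightarrow> nat \<Rightarrow> det_strategy measure \<Rightarrow> bool" where
  "randomized_strategy n k M \<longleftrightarrow>
     prob_space M \<and> (\<forall>as. (\<lambda>s. s as) \<in> M \<rightarrow>\<^sub>M count_space (codes n k))"

definition expected_guesses :: "nat \<Rightarrow> det_strategy measure \<Rightarrow> (nat \<Rightarrow> nat) \<Rightarrow> ennreal" where
  "expected_guesses n M z = (\<integral>\<^sup>+ s. ennreal_of_enat (num_guesses n s z) \<partial>M)"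

text \<open>The integrand is measurable, so \<open>expected_guesses\<close> is a genuine expectation.\<close>

lemma measurable_answers:
  assumes "randomized_strategy n k M"
  shows "(\<lambda>s. answers n s z t) \<in> M \<rightarrow>\<^sub>M count_space UNIV"
proof (induction t)
  case (Suc t)
  have c: "(\<lambda>s. s as) \<in> M \<rightarrow>\<^sub>M count_space (codes n k)" for as
    using assms by (simp add: randomized_strategy_def)
  have "(\<lambda>s. as @ [eq_pegs n z (s as)]) \<in> M \<rightarrow>\<^sub>M count_space UNIV" for as
    by (rule measurable_compose[OF c]) simp
  from measurable_compose_countable[OF this Suc] show ?case by simp
qed simp

lemma measurable_guess:
  assumes "randomized_strategy n k M"
  shows "(\<lambda>s. guess n s z t) \<in> M \<rightarrow>\<^sub>M count_space (codes n k)"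
proof -
  have c: "(\<lambda>s. s as) \<in> M \<rightarrow>\<^sub>M count_space (codes n k)" for as
    using assms by (simp add: randomized_strategy_def)
  show ?thesis
    unfolding guess_def by (rule measurable_compose_countable[OF c measurable_answers[OF assms]])
qed

lemma measurable_num_guesses:
  assumes "randomized_strategy n k M"
  shows "(\<lambda>s. num_guesses n s z) \<in> M \<rightarrow>\<^sub>M count_space UNIV"
proof -
  have [measurable]: "Measurable.pred M (\<lambda>s. guess n s z t = z)" for t
    by (rule measurable_compose[OF measurable_guess[OF assms]]) simp
  have "num_guesses n s z = (INF t. if guess n s z t = z then enat (Suc t) else \<infinity>)" for s
  proof (rule antisym)
    show "num_guesses n s z \<le> (INF t. if guess n s z t = z then enat (Suc t) else \<infinity>)"
    proof (rule INF_greatest)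
      fix t show "num_guesses n s z \<le> (if guess n s z t = z then enat (Suc t) else \<infinity>)"
        unfolding num_guesses_def by (cases "guess n s z t = z") (auto intro: INF_lower)
    qed
  next
    show "(INF t. if guess n s z t = z then enat (Suc t) else \<infinity>) \<le> num_guesses n s z"
      unfolding num_guesses_def
    proof (rule INF_greatest)
      fix t assume "t \<in> {t. guess n s z t = z}"
      then show "(INF t. if guess n s z t = z then enat (Suc t) else \<infinity>) \<le> enat (Suc t)"
        by (intro INF_lower2[of t]) simp_all
    qed
  qed
  then show ?thesis by (simp only:) measurable
qed

lemma borel_measurable_num_guesses:
  assumes "randomized_strategy n k M"
  shows "(\<lambda>s. ennreal_of_enat (num_guesses n s z)) \<in> borel_measurable M"
  by (rule measurable_compose[OF measurable_num_guesses[OF assms]]) simp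

end

(* Each colour is searched on a dyadic tree of position blocks: if the number of occurrences of
   every colour in every block of size 2^(s+1) is known, the numbers in the left halves remain to be
   found. Blocks are disjoint, so one guess can add up the answers for many blocks, and a coin
   weighing scheme of Lindstroem's type finds the numbers of all B = n / 2^(s+1) blocks in
   O(B / log B) guesses. A block contains at most min k 2^(s+1) colours, so a level costs
   O(n / log (n / 2^s)) guesses, with an additional geometric factor once 2^s exceeds k. Summing
   1 / (log n - s) over s < log k gives log (log n / log (n / k)). The guesses of this strategy
   are deterministic. *)

theory Submission
  imports Defs
begin

section \<open>Detecting families\<close>

text \<open>A black-peg guess cannot leave positions out. Adding up the answers of selected blocks
  therefore needs a colour whose contribution elsewhere is known, and such a blank must be found
  before any block search can start.

  The second obstacle is multiplicity. A colour that occurs almost 2^j times in a block is an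
  unknown of that size, and the weighing scheme pays a factor j for it. But a block of size 2^s
  holds at most 2^(s+1-j) colours that occur at least 2^(j-1) times. Treating each dyadic
  multiplicity class by itself, the factors sum like j / 2^j, so a level costs no more than if all
  counts were 0 or 1, up to a constant. The r-th colour of a class may differ from block to block;
  one guess can use a different colour in each.

  A weighing scheme is judged on the difference of two candidate count vectors: if all selected sums
  of the difference vanish, so must the difference. The factor j arises because one set A has only
  room for about card A / j digits to base 2^j.\<close>

lemma base_expansion_zero:
  fixes d :: "nat \<Rightarrow> int"
  assumes "\<And>i. i < N \<Longrightarrow> \<bar>d i\<bar> < q" and "(\<Sum>i<N. d i * q ^ i) = 0" and "i < N"
  shows "d i = 0"
  using assms
proof (induction N arbitrary: d i)
  case (Suc N)
  have eq: "d 0 + q * (\<Sum>i<N. d (Suc i) * q ^ i) = 0"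
    using Suc.prems(2) by (simp add: sum.lessThan_Suc_shift sum_distrib_left mult.left_commute del: sum.lessThan_Suc)
  \<comment> \<open>Modulo \<open>q\<close> only the lowest digit survives. It is smaller than
    \<open>q\<close> in absolute value, hence 0, and the remaining equation can be divided by
    \<open>q\<close>.\<close>
  then have "q dvd d 0"
    by (metis dvd_add_left_iff dvd_0_right dvd_triv_left)
  moreover have "\<bar>d 0\<bar> < q" using Suc.prems(1) by simp
  ultimately have d0: "d 0 = 0"
    using dvd_imp_le_int[of "d 0" q] by linarith
  have "0 < q" using \<open>\<bar>d 0\<bar> < q\<close> by linarith
  then have "(\<Sum>i<N. d (Suc i) * q ^ i) = 0" using eq d0 by simp
  then have "d (Suc i') = 0" if "i' < N" for i'
    using Suc.IH[of "\<lambda>i. d (Suc i)" i'] Suc.prems(1) that by simp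
  then show ?case using d0 Suc.prems(3) by (cases i) auto
qed simp

text \<open>Half of the subsets of a nonempty set are even: each subset of \<open>A - {a}\<close>
  becomes even by adding \<open>a\<close> or not.\<close>

lemma even_subsets_exist:
  assumes "finite A" "m < card A"
  shows "\<exists>E. E \<subseteq> {R. R \<subseteq> A \<and> even (card R)} \<and> card E = 2 ^ m"
proof -
  obtain a where a: "a \<in> A" using assms by fastforce
  let ?f = "\<lambda>B. if even (card B) then B else insert a B"
  have "inj_on ?f (Pow (A - {a}))"
    by (rule inj_onI) (auto split: if_splits)
  then have card_f: "card (?f ` Pow (A - {a})) = 2 ^ (card A - 1)"
    using assms a by (subst card_image) (simp_all add: card_Pow)
  have sub: "?f ` Pow (A - {a}) \<subseteq> {R. R \<subseteq> A \<and> even (card R)}"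
  proof -
    have "even (card (insert a B))" if "B \<subseteq> A - {a}" "odd (card B)" for B
      using that assms(1) by (subst card_insert_disjoint) (auto intro: finite_subset)
    with a show ?thesis by auto
  qed
  have "(2::nat) ^ m \<le> 2 ^ (card A - 1)"
    using assms by (intro power_increasing) auto
  then have "2 ^ m \<le> card (?f ` Pow (A - {a}))" using card_f by (simp only:)
  then obtain E where "E \<subseteq> ?f ` Pow (A - {a})" "card E = 2 ^ m"
    by (rule obtain_subset_with_card_n)
  with sub show ?thesis by (intro exI[of _ E] conjI) (rule subset_trans)
qed

text \<open>Toggling \<open>a\<close> in \<open>R\<close> changes the sign of the character but not the trace on \<open>A'\<close>.\<close>

lemma character_sum_zero:
  assumes "finite X" "a \<in> X" "a \<in> A" "a \<notin> A'"
  shows "(\<Sum>R\<in>Pow X. (- 1) ^ card (R \<inter> A) * of_bool (R \<inter> A' \<in> E)) = (0::int)"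
proof -
  define Y where "Y = X - {a}"
  have X: "X = insert a Y" "a \<notin> Y" "finite Y" using assms by (auto simp: Y_def)
  have P: "Pow X = Pow Y \<union> insert a ` Pow Y" using X by (simp add: Pow_insert)
  have "(\<Sum>R\<in>Pow X. (- 1) ^ card (R \<inter> A) * of_bool (R \<inter> A' \<in> E)) =
     (\<Sum>R\<in>Pow Y. (- 1) ^ card (R \<inter> A) * of_bool (R \<inter> A' \<in> E)) +
     (\<Sum>R\<in>insert a ` Pow Y. (- 1) ^ card (R \<inter> A) * (of_bool (R \<inter> A' \<in> E) :: int))"
    unfolding P by (rule sum.union_disjoint) (use X in auto)
  also have "(\<Sum>R\<in>insert a ` Pow Y. (- 1) ^ card (R \<inter> A) * (of_bool (R \<inter> A' \<in> E) :: int)) =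
     (\<Sum>R\<in>Pow Y. (- 1) ^ card (insert a R \<inter> A) * of_bool (insert a R \<inter> A' \<in> E))"
    by (rule sum.reindex_cong[of "insert a"]) (use X in \<open>auto simp: inj_on_def\<close>)
  also have "\<dots> = (\<Sum>R\<in>Pow Y. - ((- 1) ^ card (R \<inter> A) * of_bool (R \<inter> A' \<in> E)))"
  proof (rule sum.cong)
    fix R assume R: "R \<in> Pow Y"
    have "insert a R \<inter> A = insert a (R \<inter> A)" "insert a R \<inter> A' = R \<inter> A'" using assms by auto
    moreover have "card (insert a (R \<inter> A)) = Suc (card (R \<inter> A))"
      by (rule card_insert_disjoint) (use X R in \<open>auto intro: finite_subset\<close>)
    ultimately show "(- 1) ^ card (insert a R \<inter> A) * of_bool (insert a R \<inter> A' \<in> E) =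
      - ((- 1) ^ card (R \<inter> A) * (of_bool (R \<inter> A' \<in> E) :: int))" by simp
  qed simp
  finally show ?thesis by (simp add: sum_negf)
qed

lemma card_trace_in:
  assumes "finite X" "A \<subseteq> X" "E \<subseteq> Pow A"
  shows "card {R \<in> Pow X. R \<inter> A \<in> E} = card E * 2 ^ card (X - A)"
proof -
  have "bij_betw (\<lambda>(U, W). U \<union> W) (E \<times> Pow (X - A)) {R \<in> Pow X. R \<inter> A \<in> E}"
  proof (rule bij_betw_byWitness[where f' = "\<lambda>R. (R \<inter> A, R - A)"])
    show "\<forall>p\<in>E \<times> Pow (X - A). (\<lambda>R. (R \<inter> A, R - A)) (case p of (U, W) \<Rightarrow> U \<union> W) = p"
      using assms(3) by auto
    show "(\<lambda>(U, W). U \<union> W) ` (E \<times> Pow (X - A)) \<subseteq> {R \<in> Pow X. R \<inter> A \<in> E}"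
    proof clarsimp
      fix U W assume h: "U \<in> E" "W \<subseteq> X - A"
      then have "(U \<union> W) \<inter> A = U" using assms(3) by auto
      with h show "U \<subseteq> X \<and> W \<subseteq> X \<and> (U \<union> W) \<inter> A \<in> E" using assms by auto
    qed
  qed auto
  from bij_betw_same_card[OF this] show ?thesis
    using assms by (simp add: card_cartesian_product card_Pow)
qed

text \<open>The range of \<open>i\<close> is dictated by the supply of even sets: column
  \<open>(A, i)\<close> uses 2^(i j) of the 2^(card A - 1) even subsets of \<open>A\<close>.\<close>

definition detecting_index :: "nat \<Rightarrow> nat \<Rightarrow> (nat set \<times> nat) set" where
  "detecting_index j t = Sigma (Pow {..<t}) (\<lambda>A. {i. i * j < card A})"

lemma multiples_below:
  assumes "j > 0" "a > 0" shows "{i. i * j < a} = {..(a - 1) div j :: nat}"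
  using assms by (auto simp: less_eq_div_iff_mult_less_eq)

lemma finite_multiples_below:
  assumes "j > 0" shows "finite {i. i * j < (a :: nat)}"
  using multiples_below[OF assms, of a] by (cases "a = 0") auto

lemma finite_detecting_index:
  assumes "j > 0" shows "finite (detecting_index j t)"
  unfolding detecting_index_def using finite_multiples_below[OF assms] by (intro finite_SigmaI) auto

text \<open>Pairing each set with its complement shows that the average size is t/2, and each
  \<open>A\<close> carries at least card A / j indices. So 2^t rows serve t 2^t / (2j) columns,
  which is the logarithmic gain.\<close>

lemma card_detecting_index:
  assumes "j > 0" shows "t * 2 ^ t \<le> 2 * j * card (detecting_index j t)"
proof -
  have fin: "finite A" if "A \<in> Pow {..<t}" for A using that by (auto intro: finite_subset)
  have "(\<Sum>A\<in>Pow {..<t}. card A) = (\<Sum>A\<in>Pow {..<t}. t - card A)"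
  proof (rule sum.reindex_bij_witness[of _ "\<lambda>A. {..<t} - A" "\<lambda>A. {..<t} - A"])
    fix A assume A: "A \<in> Pow {..<t}"
    then have "card A \<le> t" using card_mono[of "{..<t}" A] by simp
    then show "t - card ({..<t} - A) = card A" using A fin by (simp add: card_Diff_subset)
  qed auto
  then have "2 * (\<Sum>A\<in>Pow {..<t}. card A) = (\<Sum>A\<in>Pow {..<t}. card A + (t - card A))"
    by (simp add: sum.distrib)
  also have "\<dots> = (\<Sum>A\<in>Pow {..<t}. t)"
  proof (rule sum.cong)
    fix A assume "A \<in> Pow {..<t}"
    then have "card A \<le> t" using card_mono[of "{..<t}" A] by simp
    then show "card A + (t - card A) = t" by simp
  qed simp
  finally have two: "2 * (\<Sum>A\<in>Pow {..<t}. card A) = t * 2 ^ t" by (simp add: card_Pow)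
  have le: "card A \<le> j * card {i. i * j < card A}" for A :: "nat set"
  proof (cases "card A = 0")
    case False
    have "{i. i * j < card A} = {..(card A - 1) div j}"
      using assms False by (intro multiples_below) auto
    moreover have "card A - 1 < j * Suc ((card A - 1) div j)"
      using assms dividend_less_times_div[of j "card A - 1"] by simp
    ultimately show ?thesis by simp
  qed simp
  have "(\<Sum>A\<in>Pow {..<t}. card A) \<le> (\<Sum>A\<in>Pow {..<t}. j * card {i. i * j < card A})"
    by (rule sum_mono) (rule le)
  also have "\<dots> = j * card (detecting_index j t)"
    unfolding detecting_index_def
    using finite_multiples_below[OF assms] by (subst card_SigmaI) (auto simp: sum_distrib_left)
  finally show ?thesis using two by simp
qed

text \<open>
  Row \<open>R\<close> contains column \<open>(A, i)\<close> iff \<open>R \<inter> A\<close> lies in a fixed family of \<open>2 ^ (i * j)\<close> even subsets of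
  \<open>A\<close>. The character of \<open>A\<close> vanishes on the columns of every \<open>A'\<close> that does not contain \<open>A\<close>, and on
  those of \<open>A\<close> itself it takes values proportional to the powers of \<open>2 ^ j\<close>. Hence, for a maximal \<open>A\<close>
  with \<open>\<delta> \<noteq> 0\<close>, the \<open>\<delta> (A, i)\<close> would be the digits of an expansion of zero.
\<close>

lemma detecting_rows:
  assumes j: "j > 0"
  shows "\<exists>row :: nat set \<Rightarrow> (nat set \<times> nat) set. (\<forall>R. row R \<subseteq> detecting_index j t) \<and>
    (\<forall>\<delta> :: nat set \<times> nat \<Rightarrow> int.
       (\<forall>p\<in>detecting_index j t. \<bar>\<delta> p\<bar> < 2 ^ j) \<longrightarrow>
       (\<forall>R\<in>Pow {..<t}. sum \<delta> (row R) = 0) \<longrightarrow> (\<forall>p\<in>detecting_index j t. \<delta> p = 0))"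
proof -
  let ?I = "detecting_index j t"
  note fI = finite_detecting_index[OF j, of t]
  have "\<exists>E. \<forall>p\<in>?I. E p \<subseteq> {R. R \<subseteq> fst p \<and> even (card R)} \<and> card (E p) = 2 ^ (snd p * j)"
    by (rule bchoice) (auto simp: detecting_index_def intro!: even_subsets_exist intro: finite_subset)
  then obtain E where E: "\<And>p. p \<in> ?I \<Longrightarrow> E p \<subseteq> {R. R \<subseteq> fst p \<and> even (card R)}"
      "\<And>p. p \<in> ?I \<Longrightarrow> card (E p) = 2 ^ (snd p * j)" by blast
  define row where "row R = {p \<in> ?I. R \<inter> fst p \<in> E p}" for R
  have "\<delta> (A, i) = 0"
    if d: "\<forall>p\<in>?I. \<bar>\<delta> p\<bar> < (2::int) ^ j" and z: "\<forall>R\<in>Pow {..<t}. sum \<delta> (row R) = 0"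
      and "(A, i) \<in> ?I" for \<delta> A i
    using that(3)
  proof (induction "t - card A" arbitrary: A i rule: less_induct)
    case less
    have A: "A \<subseteq> {..<t}" "finite A" using less.prems by (auto simp: detecting_index_def intro: finite_subset)
    define w where "w p = (\<Sum>R\<in>Pow {..<t}. (- 1) ^ card (R \<inter> A) * (of_bool (R \<inter> fst p \<in> E p) :: int))" for p
    have "0 = (\<Sum>R\<in>Pow {..<t}. (- 1) ^ card (R \<inter> A) * sum \<delta> (row R))" using z by simp
    also have "\<dots> = (\<Sum>R\<in>Pow {..<t}. \<Sum>p\<in>?I. (- 1) ^ card (R \<inter> A) * (of_bool (R \<inter> fst p \<in> E p) * \<delta> p))"
    proof (rule sum.cong)
      fix R
      have "sum \<delta> (row R) = (\<Sum>p\<in>?I. of_bool (R \<inter> fst p \<in> E p) * \<delta> p)"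
        unfolding row_def by (simp add: sum.inter_filter[OF fI] of_bool_def if_distrib[of "\<lambda>x. x * _"] cong: if_cong)
      then show "(- 1) ^ card (R \<inter> A) * sum \<delta> (row R) =
          (\<Sum>p\<in>?I. (- 1) ^ card (R \<inter> A) * (of_bool (R \<inter> fst p \<in> E p) * \<delta> p))"
        by (simp add: sum_distrib_left)
    qed simp
    also have "\<dots> = (\<Sum>p\<in>?I. w p * \<delta> p)"
      unfolding w_def by (subst sum.swap) (simp only: sum_distrib_right mult.assoc)
    also have "\<dots> = (\<Sum>p\<in>{A} \<times> {i. i * j < card A}. w p * \<delta> p)"
    proof (rule sum.mono_neutral_right[OF fI])
      show "{A} \<times> {i. i * j < card A} \<subseteq> ?I" using A by (auto simp: detecting_index_def)
      show "\<forall>p\<in>?I - {A} \<times> {i. i * j < card A}. w p * \<delta> p = 0"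
      proof
        fix p assume p: "p \<in> ?I - {A} \<times> {i. i * j < card A}"
        obtain A' i' where p': "p = (A', i')" by (cases p)
        have A': "A' \<subseteq> {..<t}" "A' \<noteq> A" using p p' by (auto simp: detecting_index_def)
        show "w p * \<delta> p = 0"
        proof (cases "A \<subseteq> A'")
          case True
          then have "card A < card A'" using A' by (intro psubset_card_mono) (auto intro: finite_subset)
          moreover have "card A' \<le> t" using A' card_mono[of "{..<t}" A'] by simp
          ultimately have "\<delta> (A', i') = 0" using p p' by (intro less.hyps) auto
          then show ?thesis using p' by simp
        next
          case False
          then obtain a where "a \<in> A" "a \<notin> A'" by auto
          then have "w p = 0" unfolding w_def p' using A by (intro character_sum_zero[of _ a]) auto
          then show ?thesis by simp
        qed
      qed
    qed
    also have "\<dots> = (\<Sum>i | i * j < card A. w (A, i) * \<delta> (A, i))"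
      by (rule sum.reindex_bij_witness[of _ "Pair A" snd]) auto
    also have "\<dots> = (\<Sum>i | i * j < card A. 2 ^ card ({..<t} - A) * (\<delta> (A, i) * (2 ^ j) ^ i))"
    proof (rule sum.cong)
      fix i assume "i \<in> {i. i * j < card A}"
      then have I: "(A, i) \<in> ?I" using A by (auto simp: detecting_index_def)
      \<comment> \<open>All rows that count here meet \<open>A\<close> in an even set, so every sign
        is 1 and \<open>w\<close> becomes a plain count.\<close>
      have "w (A, i) = (\<Sum>R\<in>Pow {..<t}. of_bool (R \<inter> A \<in> E (A, i)))"
        unfolding w_def using E(1)[OF I] by (intro sum.cong) (auto simp: of_bool_def)
      also have "\<dots> = int (card {R \<in> Pow {..<t}. R \<inter> A \<in> E (A, i)})"
        by (simp add: of_bool_def sum.inter_filter[symmetric])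
      also have "\<dots> = 2 ^ (i * j) * 2 ^ card ({..<t} - A)"
        using E[OF I] A by (subst card_trace_in) auto
      finally show "w (A, i) * \<delta> (A, i) = 2 ^ card ({..<t} - A) * (\<delta> (A, i) * (2 ^ j) ^ i)"
        by (simp add: power_mult[symmetric] mult_ac)
    qed simp
    also have "\<dots> = 2 ^ card ({..<t} - A) * (\<Sum>i | i * j < card A. \<delta> (A, i) * (2 ^ j) ^ i)"
      by (simp add: sum_distrib_left)
    finally have "(\<Sum>i | i * j < card A. \<delta> (A, i) * (2 ^ j) ^ i) = 0" by simp
    moreover have "{i. i * j < card A} = {..<Suc ((card A - 1) div j)}"
      using less.prems j by (subst multiples_below) (auto simp: detecting_index_def)
    ultimately show "\<delta> (A, i) = 0"
      using less.prems d A by (intro base_expansion_zero[of "Suc ((card A - 1) div j)" "\<lambda>i. \<delta> (A, i)" "2 ^ j"])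
        (auto simp: detecting_index_def set_eq_iff)
  qed
  then show ?thesis
    by (intro exI[of _ row]) (auto simp: row_def)
qed

text \<open>Take the least \<open>t\<close> that supplies \<open>B\<close> columns. Then t 2^t is of
  order j B, t is at least of order log B, and the number of rows is at most 2^t.\<close>

lemma detecting_family:
  assumes j: "j > 0" and B: "B > 0"
  shows "\<exists>\<R> \<subseteq> Pow {..<B :: nat}. real (card \<R>) \<le> 16 * real j * real B / log 2 (real B + 1) \<and>
    (\<forall>\<delta> :: nat \<Rightarrow> int. (\<forall>b<B. \<bar>\<delta> b\<bar> < 2 ^ j) \<longrightarrow> (\<forall>R\<in>\<R>. sum \<delta> R = 0) \<longrightarrow> (\<forall>b<B. \<delta> b = 0))"
proof -
  define t where "t = (LEAST t. 2 * j * B \<le> t * 2 ^ t)"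
  have ex: "2 * j * B \<le> (2 * j * B) * 2 ^ (2 * j * B)" by simp
  have t1: "2 * j * B \<le> t * 2 ^ t"
    unfolding t_def using ex by (rule LeastI)
  have t2: "t' * 2 ^ t' < 2 * j * B" if "t' < t" for t'
    using not_less_Least[of t' "\<lambda>t. 2 * j * B \<le> t * 2 ^ t"] that unfolding t_def by auto
  have "t > 0" using t1 j B by (cases t) auto
  have size: "2 ^ t \<le> 16 * real j * real B / log 2 (real B + 1)"
  proof -
    have "real B + 1 \<le> 2 * real j * real B"
    proof -
      have "1 * B \<le> j * B" using j by (intro mult_right_mono) simp_all
      moreover have "1 \<le> B" using B by simp
      ultimately have "B + 1 \<le> 2 * (j * B)" by linarith
      then have "B + 1 \<le> 2 * j * B" by simp
      then show ?thesis by (metis of_nat_1 of_nat_add of_nat_le_iff of_nat_mult of_nat_numeral)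
    qed
    also have "\<dots> \<le> real (t * 2 ^ t)" using t1 by (metis of_nat_le_iff of_nat_mult of_nat_numeral)
    \<comment> \<open>The crude bound t \<le> 2^t suffices: it gives B + 1 \<le> 4^t and loses only
      a factor 2 in the logarithm.\<close>
    also have "\<dots> \<le> 2 ^ t * 2 ^ t"
      using of_nat_less_two_power[of t, where 'a = real] by simp
    also have "\<dots> = 2 powr (2 * real t)" by (simp add: powr_realpow[symmetric] powr_add[symmetric])
    finally have "log 2 (real B + 1) \<le> 2 * real t" by (subst log_le_iff) auto
    moreover have "2 ^ t * real t \<le> 8 * real j * real B"
    \<comment> \<open>Minimality bounds (t-1) 2^(t-1), and t \<le> 2 (t-1) needs t \<ge> 2. The 8
      obtained here, times the 2 lost in the logarithm, is the constant 16.\<close>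
    proof (cases "t = 1")
      case True
      have "1 \<le> j * B" using j B by simp
      then have "1 \<le> real (j * B)" by (metis of_nat_1 of_nat_le_iff)
      then have "2 \<le> 8 * real j * real B" unfolding of_nat_mult mult.assoc by linarith
      then show ?thesis using True by simp
    next
      case False
      define t' where "t' = t - 1"
      have t': "t = Suc t'" "t' \<ge> 1" using False \<open>t > 0\<close> by (auto simp: t'_def)
      have "t' * 2 ^ t' \<le> 2 * j * B" using t2[of t'] t'(1) by linarith
      then have "real t' * 2 ^ t' \<le> 2 * real j * real B"
        by (metis of_nat_le_iff of_nat_mult of_nat_numeral of_nat_power)
      moreover have "(2 ^ t * real t :: real) \<le> 4 * (real t' * 2 ^ t')"
        using t' by (simp add: algebra_simps)
      ultimately show ?thesis by linarith
    qed
    ultimately have "2 ^ t * log 2 (real B + 1) \<le> 16 * real j * real B"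
    proof -
      assume a: "log 2 (real B + 1) \<le> 2 * real t" and b: "2 ^ t * real t \<le> 8 * real j * real B"
      have "2 ^ t * log 2 (real B + 1) \<le> 2 ^ t * (2 * real t)" using a by (intro mult_left_mono) auto
      then show ?thesis using b by linarith
    qed
    moreover have "log 2 (real B + 1) > 0" using B by simp
    ultimately show ?thesis by (simp add: field_simps)
  qed
  let ?I = "detecting_index j t"
  have "2 * j * B \<le> 2 * j * card ?I" using t1 card_detecting_index[OF j, of t] by (rule order_trans)
  then have "card {..<B} \<le> card ?I" using j by simp
  then obtain \<phi> where \<phi>: "inj_on \<phi> {..<B}" "\<phi> ` {..<B} \<subseteq> ?I"
    using card_le_inj[OF finite_lessThan finite_detecting_index[OF j]] by (metis inj_on_def image_subset_iff)
  obtain row where row: "\<And>R. row R \<subseteq> ?I"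
    "\<And>\<delta> :: nat set \<times> nat \<Rightarrow> int. (\<forall>p\<in>?I. \<bar>\<delta> p\<bar> < 2 ^ j) \<Longrightarrow>
       (\<forall>R\<in>Pow {..<t}. sum \<delta> (row R) = 0) \<Longrightarrow> (\<forall>p\<in>?I. \<delta> p = 0)"
    using detecting_rows[OF j, of t] by metis
  define \<R> where "\<R> = (\<lambda>R. {b \<in> {..<B}. \<phi> b \<in> row R}) ` Pow {..<t}"
  have "card \<R> \<le> 2 ^ t"
    using card_image_le[of "Pow {..<t}" "\<lambda>R. {b \<in> {..<B}. \<phi> b \<in> row R}"] by (simp add: \<R>_def card_Pow)
  then have "real (card \<R>) \<le> 2 ^ t" by (metis of_nat_le_iff of_nat_numeral of_nat_power)
  then have "real (card \<R>) \<le> 16 * real j * real B / log 2 (real B + 1)"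
    using size by (rule order_trans)
  moreover have "\<delta> b = 0" if d: "\<forall>b<B. \<bar>\<delta> b\<bar> < (2::int) ^ j" "\<forall>R\<in>\<R>. sum \<delta> R = 0" "b < B" for \<delta> b
  proof -
    \<comment> \<open>Surplus columns outside the image of \<open>\<phi>\<close> receive the value 0
      and do not disturb the row sums.\<close>
    define \<delta>' where "\<delta>' p = (if p \<in> \<phi> ` {..<B} then \<delta> (the_inv_into {..<B} \<phi> p) else 0)" for p
    have \<delta>': "\<delta>' (\<phi> b) = \<delta> b" if "b < B" for b
      using that \<phi> by (simp add: \<delta>'_def the_inv_into_f_f)
    have "\<forall>p\<in>?I. \<delta>' p = 0"
    proof (rule row(2))
      show "\<forall>p\<in>?I. \<bar>\<delta>' p\<bar> < 2 ^ j"
        using d(1) \<delta>' by (auto simp: \<delta>'_def the_inv_into_f_f[OF \<phi>(1)])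
      show "\<forall>R\<in>Pow {..<t}. sum \<delta>' (row R) = 0"
      proof
        fix R assume R: "R \<in> Pow {..<t}"
        have "sum \<delta>' (row R) = sum \<delta>' (\<phi> ` {b \<in> {..<B}. \<phi> b \<in> row R})"
        proof (rule sum.mono_neutral_right)
          show "finite (row R)" using row(1) finite_detecting_index[OF j] finite_subset by blast
        qed (auto simp: \<delta>'_def)
        also have "\<dots> = sum \<delta> {b \<in> {..<B}. \<phi> b \<in> row R}"
          by (subst sum.reindex) (auto intro: inj_on_subset[OF \<phi>(1)] simp: \<delta>')
        also have "\<dots> = 0" using d(2) R by (auto simp: \<R>_def)
        finally show "sum \<delta>' (row R) = 0" .
      qed
    qed
    then show ?thesis using \<phi> \<delta>' that(3) by (metis image_subset_iff lessThan_iff)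
  qed
  moreover have "\<R> \<subseteq> Pow {..<B}" by (auto simp: \<R>_def)
  ultimately show ?thesis by (intro exI[of _ \<R>] conjI allI impI) auto
qed

section \<open>Adaptive queries\<close>

text \<open>
  A decision tree of depth \<open>T\<close> whose leaves know the value of \<open>g\<close>, given that the code lies in \<open>Z\<close>.
\<close>

primrec determines :: "nat \<Rightarrow> nat \<Rightarrow> nat \<Rightarrow> (nat \<Rightarrow> nat) set \<Rightarrow> ((nat \<Rightarrow> nat) \<Rightarrow> 'a) \<Rightarrow> bool" where
  "determines n k 0 Z g = (\<forall>z\<in>Z. \<forall>z'\<in>Z. g z = g z')"
| "determines n k (Suc T) Z g = (\<exists>x\<in>codes n k. \<forall>a. determines n k T {z \<in> Z. eq_pegs n z x = a} g)"

lemma determines_subset: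
  "determines n k T Z g \<Longrightarrow> Z' \<subseteq> Z \<Longrightarrow> determines n k T Z' g"
proof (induction T arbitrary: Z Z')
  case (Suc T)
  obtain x where x: "x \<in> codes n k" "\<And>a. determines n k T {z \<in> Z. eq_pegs n z x = a} g"
    using Suc.prems(1) by auto
  have "determines n k T {z \<in> Z'. eq_pegs n z x = a} g" for a
    by (rule Suc.IH[OF x(2)[of a]]) (use Suc.prems in auto)
  with x(1) show ?case by auto
qed auto

text \<open>The second tree is hung below the leaves of the first and may depend on the value of
  \<open>g\<close> known there. This is where the search becomes adaptive.\<close>

lemma determines_compose:
  assumes "determines n k T Z g"
    and "\<And>v. determines n k T' {z \<in> Z. g z = v} h"
  shows "determines n k (T + T') Z h"
  using assms
proof (induction T arbitrary: Z)
  case 0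
  show ?case
  proof (cases "Z = {}")
    case False
    then obtain z0 where "z0 \<in> Z" by auto
    then have "{z \<in> Z. g z = g z0} = Z" using 0(1) unfolding determines.simps by blast
    then show ?thesis using 0(2)[of "g z0"] by simp
  next
    case True
    then have "{z \<in> Z. g z = undefined} = Z" by simp
    then show ?thesis using 0(2)[of undefined] by simp
  qed
next
  case (Suc T)
  obtain x where x: "x \<in> codes n k" "\<And>a. determines n k T {z \<in> Z. eq_pegs n z x = a} g"
    using Suc.prems(1) by auto
  have "determines n k (T + T') {z \<in> Z. eq_pegs n z x = a} h" for a
    by (rule Suc.IH[OF x(2)]) (rule determines_subset[OF Suc.prems(2)], auto)
  with x(1) show ?case by auto
qed

lemma determines_constant:
  assumes "\<And>z z'. z \<in> Z \<Longrightarrow> z' \<in> Z \<Longrightarrow> h z = h z'"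
  shows "determines n k 0 Z h"
  unfolding determines.simps using assms by blast

lemma determines_factor:
  assumes "determines n k T Z g"
    and "\<And>z z'. z \<in> Z \<Longrightarrow> z' \<in> Z \<Longrightarrow> g z = g z' \<Longrightarrow> h z = h z'"
  shows "determines n k T Z h"
proof -
  have "determines n k (T + 0) Z h"
    by (rule determines_compose[OF assms(1)], rule determines_constant, rule assms(2)) auto
  then show ?thesis by simp
qed

lemma determines_family:
  assumes "finite J" "\<And>i. i \<in> J \<Longrightarrow> determines n k (T i) Z (g i)"
    and "\<And>z z'. z \<in> Z \<Longrightarrow> z' \<in> Z \<Longrightarrow> (\<And>i. i \<in> J \<Longrightarrow> g i z = g i z') \<Longrightarrow> h z = h z'"
  shows "determines n k (sum T J) Z h"
  using assms
proof (induction J arbitrary: Z rule: finite_induct)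
  case empty
  show ?case unfolding sum.empty by (rule determines_constant, rule empty(2)) auto
next
  case (insert i J)
  have "determines n k (T i + sum T J) Z h"
  proof (rule determines_compose)
    show "determines n k (T i) Z (g i)" using insert by simp
    show "determines n k (sum T J) {z \<in> Z. g i z = v} h" for v
    proof (rule insert.IH)
      show "determines n k (T i') {z \<in> Z. g i z = v} (g i')" if "i' \<in> J" for i'
        using insert.prems(1)[of i'] that by (auto intro: determines_subset)
      show "h z = h z'" if "z \<in> {z \<in> Z. g i z = v}" "z' \<in> {z \<in> Z. g i z = v}"
        "\<And>i'. i' \<in> J \<Longrightarrow> g i' z = g i' z'" for z z'
        by (rule insert.prems(2)) (use that in auto)
    qed
  qed
  then show ?case using insert by simp
qed

lemma determines_query:
  assumes "x \<in> codes n k"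
    and "\<And>z z'. z \<in> Z \<Longrightarrow> z' \<in> Z \<Longrightarrow> eq_pegs n z x = eq_pegs n z' x \<Longrightarrow> h z = h z'"
  shows "determines n k 1 Z h"
proof -
  have "determines n k 0 {z \<in> Z. eq_pegs n z x = a} h" for a
    by (rule determines_constant) (use assms(2) in auto)
  then show ?thesis using assms(1) unfolding One_nat_def determines.simps(2) by blast
qed

section \<open>From decision trees to strategies\<close>

lemma answers_Cons:
  "answers n s z (Suc t) = eq_pegs n z (s []) # answers n (\<lambda>as. s (eq_pegs n z (s []) # as)) z t"
proof (induction t)
  case (Suc t)
  show ?case
    by (simp only: answers.simps(2)[of _ _ _ "Suc t"] Suc.IH) simp
qed simp

text \<open>The answer at the root is the oldest entry of the history, so the strategy reads the
  list from the front and passes its tail to the chosen subtree. The leaf is reached after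
  \<open>T\<close> answers and names the code in guess \<open>T\<close>, counted from 0. Histories
  that no code produces must still yield a code, as \<open>randomized_strategy\<close>
  requires.\<close>

lemma determines_strategy:
  assumes "determines n k T Z id" "codes n k \<noteq> {}" "Z \<subseteq> codes n k"
  shows "\<exists>s. (\<forall>as. s as \<in> codes n k) \<and> (\<forall>z\<in>Z. guess n s z T = z)"
  using assms(1,3)
proof (induction T arbitrary: Z)
  case 0
  show ?case
  proof (cases "Z = {}")
    case True
    then show ?thesis using assms(2) by auto
  next
    case False
    then obtain z0 where "z0 \<in> Z" by auto
    with 0 show ?thesis by (intro exI[of _ "\<lambda>_. z0"]) (auto simp: guess_def)
  qed
next
  case (Suc T)
  obtain x where x: "x \<in> codes n k" "\<And>a. determines n k T {z \<in> Z. eq_pegs n z x = a} id"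
    using Suc.prems(1) unfolding determines.simps by blast
  have "\<forall>a. \<exists>s. (\<forall>as. s as \<in> codes n k) \<and> (\<forall>z\<in>{z \<in> Z. eq_pegs n z x = a}. guess n s z T = z)"
    by (intro allI, rule Suc.IH[OF x(2)]) (use Suc.prems(2) in blast)
  from choice[OF this] obtain S
    where S: "\<forall>a. (\<forall>as. S a as \<in> codes n k) \<and> (\<forall>z\<in>{z \<in> Z. eq_pegs n z x = a}. guess n (S a) z T = z)" ..
  have S1: "S a as \<in> codes n k" for a as using S by simp
  have S2: "guess n (S (eq_pegs n z x)) z T = z" if "z \<in> Z" for z
    using S[rule_format, of "eq_pegs n z x"] that by simp
  define s where "s = (\<lambda>as. case as of [] \<Rightarrow> x | a # as \<Rightarrow> S a as)"
  have "guess n s z (Suc T) = z" if "z \<in> Z" for z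
    using S2[OF that] unfolding guess_def answers_Cons by (simp add: s_def)
  moreover have "s as \<in> codes n k" for as using S1 x(1) by (auto simp: s_def split: list.split)
  ultimately show ?case by blast
qed

lemma expected_guesses_determines:
  assumes "determines n k T (codes n k) id" "codes n k \<noteq> {}" "real T + 1 \<le> c"
  shows "\<exists>M. randomized_strategy n k M \<and> (\<forall>z\<in>codes n k. expected_guesses n M z \<le> ennreal c)"
proof -
  obtain s where s: "\<And>as. s as \<in> codes n k" "\<And>z. z \<in> codes n k \<Longrightarrow> guess n s z T = z"
    using determines_strategy[OF assms(1,2)] by auto
  \<comment> \<open>A point mass on a one-point space, where all evaluation maps are
    measurable.\<close>
  define M where "M = return (count_space {s}) s"
  have "randomized_strategy n k M"
    unfolding randomized_strategy_def M_def using s(1) by (auto intro!: prob_space_return)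
  moreover have "expected_guesses n M z \<le> ennreal c" if z: "z \<in> codes n k" for z
  proof -
    have "num_guesses n s z \<le> enat (Suc T)"
      unfolding num_guesses_def using s(2)[OF z] by (intro INF_lower) simp
    then obtain m where m: "num_guesses n s z = enat m" "m \<le> Suc T" by (cases "num_guesses n s z") auto
    have "expected_guesses n M z = ennreal_of_enat (num_guesses n s z)"
      unfolding expected_guesses_def M_def by (subst nn_integral_return) auto
    also have "\<dots> = ennreal (real m)" using m by (simp add: ennreal_of_nat_eq_real_of_nat)
    also have "\<dots> \<le> ennreal c" using m assms(3) by (intro ennreal_leI) linarith
    finally show ?thesis .
  qed
  ultimately show ?thesis by auto
qed

section \<open>Search on dyadic blocks\<close>

text \<open>A tree makes exactly \<open>T\<close> guesses, so enlarging \<open>T\<close> means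
  padding with arbitrary guesses; for these some code must exist.\<close>

lemma determines_constant_any:
  assumes "\<And>z z'. z \<in> Z \<Longrightarrow> z' \<in> Z \<Longrightarrow> h z = h z'" "codes n k \<noteq> {}"
  shows "determines n k T Z h"
  using assms(1)
proof (induction T arbitrary: Z)
  case 0
  show ?case by (rule determines_constant) (rule 0)
next
  case (Suc T)
  obtain x where "x \<in> codes n k" using assms(2) by blast
  moreover have "determines n k T {z \<in> Z. eq_pegs n z x = a} h" for a
    by (rule Suc.IH) (rule Suc.prems, auto)
  ultimately show ?case unfolding determines.simps by blast
qed

lemma determines_le:
  assumes "determines n k T Z g" "T \<le> T'" "codes n k \<noteq> {}"
  shows "determines n k T' Z g"
proof -
  have "determines n k (T + (T' - T)) Z g"
    by (rule determines_compose[OF assms(1)], rule determines_constant_any[OF _ assms(3)]) simp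
  then show ?thesis using assms(2) by simp
qed

lemma codes_nonempty: "k \<ge> 1 \<Longrightarrow> codes n k \<noteq> {}"
  by (auto simp: codes_def PiE_eq_empty_iff)

lemma eq_pegs_if:
  assumes "P \<subseteq> {1..n}"
  shows "eq_pegs n z (\<lambda>i\<in>{1..n}. if i \<in> P then x i else y i) =
    card {i \<in> P. z i = x i} + card {i \<in> {1..n} - P. z i = y i}"
proof -
  have "{i \<in> {1..n}. z i = (\<lambda>i\<in>{1..n}. if i \<in> P then x i else y i) i} =
      {i \<in> P. z i = x i} \<union> {i \<in> {1..n} - P. z i = y i}" using assms by auto
  then show ?thesis unfolding eq_pegs_def
    using finite_subset[OF assms] by (simp only:) (rule card_Un_disjoint, auto)
qed

definition detect_cost :: "nat \<Rightarrow> nat \<Rightarrow> nat" where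
  "detect_cost j B = nat \<lfloor>16 * real j * real B / log 2 (real B + 1)\<rfloor>"

text \<open>Applies the detecting family to the difference of two codes that are still possible, so
  only differences are bounded. Values are integers because the search for the blank weighs signed
  quantities.\<close>

lemma determines_detect:
  fixes v :: "(nat \<Rightarrow> nat) \<Rightarrow> nat \<Rightarrow> int"
  assumes "j > 0" "B > 0" "k \<ge> 1"
    and query: "\<And>R. R \<subseteq> {..<B} \<Longrightarrow> determines n k 1 Z (\<lambda>z. sum (v z) R)"
    and bound: "\<And>z z' b. z \<in> Z \<Longrightarrow> z' \<in> Z \<Longrightarrow> b < B \<Longrightarrow> \<bar>v z b - v z' b\<bar> < 2 ^ j"
    and h: "\<And>z z'. z \<in> Z \<Longrightarrow> z' \<in> Z \<Longrightarrow> (\<And>b. b < B \<Longrightarrow> v z b = v z' b) \<Longrightarrow> h z = h z'"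
  shows "determines n k (detect_cost j B) Z h"
proof -
  obtain \<R> where R: "\<R> \<subseteq> Pow {..<B}" "real (card \<R>) \<le> 16 * real j * real B / log 2 (real B + 1)"
    "\<And>\<delta> :: nat \<Rightarrow> int. (\<forall>b<B. \<bar>\<delta> b\<bar> < 2 ^ j) \<Longrightarrow> (\<forall>R\<in>\<R>. sum \<delta> R = 0) \<Longrightarrow> (\<forall>b<B. \<delta> b = 0)"
    using detecting_family[OF assms(1,2)] by blast
  have "determines n k (\<Sum>R\<in>\<R>. 1) Z h"
  proof (rule determines_family)
    show "finite \<R>" using R(1) by (rule finite_subset) simp
    show "determines n k 1 Z (\<lambda>z. sum (v z) R)" if "R \<in> \<R>" for R using R(1) that by (intro query) auto
    show "h z = h z'" if z: "z \<in> Z" "z' \<in> Z" and eq: "\<And>R. R \<in> \<R> \<Longrightarrow> sum (v z) R = sum (v z') R" for z z'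
    proof (rule h[OF z])
      have "\<forall>b<B. v z b - v z' b = 0"
        by (rule R(3)) (use bound[OF z] eq in \<open>auto simp: sum_subtractf\<close>)
      then show "v z b = v z' b" if "b < B" for b using that by simp
    qed
  qed
  moreover have "(\<Sum>R\<in>\<R>. 1) \<le> detect_cost j B"
    unfolding detect_cost_def using R(2) by (simp add: le_nat_floor)
  ultimately show ?thesis using codes_nonempty[OF assms(3)] by (rule determines_le)
qed

text \<open>Once its positions are known, colour 1 serves as a blank.\<close>

lemma determines_blank_query:
  assumes "k \<ge> 1" "P \<subseteq> {1..n}" "\<And>i. i \<in> P \<Longrightarrow> x i \<in> {1..k}"
    and blank: "\<And>z z' i. z \<in> Z \<Longrightarrow> z' \<in> Z \<Longrightarrow> i \<in> {1..n} \<Longrightarrow> z i = 1 \<longleftrightarrow> z' i = 1"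
  shows "determines n k 1 Z (\<lambda>z. int (card {i \<in> P. z i = x i}))"
proof (rule determines_query)
  show "(\<lambda>i\<in>{1..n}. if i \<in> P then x i else 1) \<in> codes n k"
    unfolding codes_def using assms by (auto intro!: restrict_PiE)
  fix z z' assume z: "z \<in> Z" "z' \<in> Z"
  have "{i \<in> {1..n} - P. z i = 1} = {i \<in> {1..n} - P. z' i = 1}" using blank[OF z] by blast
  then show "int (card {i \<in> P. z i = x i}) = int (card {i \<in> P. z' i = x i})"
    if "eq_pegs n z (\<lambda>i\<in>{1..n}. if i \<in> P then x i else 1) = eq_pegs n z' (\<lambda>i\<in>{1..n}. if i \<in> P then x i else 1)"
    using that unfolding eq_pegs_if[OF assms(2)] by simp
qed

section \<open>From blocks to half blocks\<close>

definition color_count :: "nat \<Rightarrow> nat \<Rightarrow> (nat \<Rightarrow> nat) \<Rightarrow> nat \<times> nat \<Rightarrow> nat" where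
  "color_count n s z = (\<lambda>(b, c). card {i \<in> {1..n}. i div 2 ^ s = b \<and> z i = c})"

lemma card_block_le: "card {i \<in> {1..n :: nat}. i div 2 ^ s = b} \<le> 2 ^ s"
proof -
  have "{i \<in> {1..n}. i div 2 ^ s = b} \<subseteq> {b * 2 ^ s..<b * 2 ^ s + 2 ^ s}"
  proof
    fix i :: nat assume "i \<in> {i \<in> {1..n}. i div 2 ^ s = b}"
    then have "b = i div 2 ^ s" by simp
    then show "i \<in> {b * 2 ^ s..<b * 2 ^ s + 2 ^ s}"
      using div_mult_mod_eq[of i "2 ^ s"] mod_less_divisor[of "2 ^ s" i, OF zero_less_power]
      by (simp only: atLeastLessThan_iff) linarith
  qed
  from card_mono[OF _ this] show ?thesis by simp
qed

lemma color_count_Suc: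
  "color_count n (Suc s) z (b, c) = color_count n s z (2 * b, c) + color_count n s z (2 * b + 1, c)"
proof -
  have d: "i div 2 ^ Suc s = i div 2 ^ s div 2" for i :: nat
    by (simp only: power_Suc2 div_mult2_eq)
  have "{i \<in> {1..n}. i div 2 ^ Suc s = b \<and> z i = c} =
    {i \<in> {1..n}. i div 2 ^ s = 2 * b \<and> z i = c} \<union> {i \<in> {1..n}. i div 2 ^ s = 2 * b + 1 \<and> z i = c}"
    unfolding d by auto
  then show ?thesis unfolding color_count_def prod.case
    by (simp only:) (rule card_Un_disjoint, auto)
qed

text \<open>The index \<open>j\<close> stands for the colours that occur between \<open>2 ^ (j - 1)\<close> and \<open>2 ^ j - 1\<close> times in a block.\<close>

definition level_cost :: "nat \<Rightarrow> nat \<Rightarrow> nat \<Rightarrow> nat" where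
  "level_cost n k s = (\<Sum>j\<in>{1..Suc s}. min k (2 ^ (Suc s - j)) * detect_cost j (n div 2 ^ s + 1))"

text \<open>For each class \<open>j\<close> and rank \<open>r\<close> one detecting scheme runs over
  all blocks simultaneously: in the left half of every selected block the guess shows that block's
  own \<open>r\<close>-th colour of class \<open>j\<close>, and everywhere else the blank.\<close>

lemma determines_refine:
  assumes k: "k \<ge> 1" and Z: "Z \<subseteq> codes n k"
    and blank: "\<And>z z' i. z \<in> Z \<Longrightarrow> z' \<in> Z \<Longrightarrow> i \<in> {1..n} \<Longrightarrow> z i = 1 \<longleftrightarrow> z' i = 1"
    and known: "\<And>z. z \<in> Z \<Longrightarrow> color_count n (Suc s) z = a"
  shows "determines n k (level_cost n k (Suc s)) Z (color_count n s)"
proof (cases "Z = {}")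
  case True
  then show ?thesis by (intro determines_constant_any codes_nonempty k) auto
next
  case False
  then obtain z0 where z0: "z0 \<in> Z" by auto
  define B where "B = n div 2 ^ Suc s + 1"
  have div_lt: "i div 2 ^ Suc s < B" if "i \<in> {1..n}" for i
    using that unfolding B_def by (auto simp: less_Suc_eq_le intro: div_le_mono)
  have half: "i div 2 ^ Suc s = i div 2 ^ s div 2" for i :: nat
    by (simp only: power_Suc2 div_mult2_eq)
  define Q where "Q j b = {c \<in> {1..k}. 2 ^ (j - 1) \<le> a (b, c) \<and> a (b, c) < 2 ^ j}" for j b
  have finQ: "finite (Q j b)" for j b by (simp add: Q_def)
  have "\<forall>j b. \<exists>e. bij_betw e {0..<card (Q j b)} (Q j b)"
    using ex_bij_betw_nat_finite[OF finQ] by blast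
  then obtain e where e: "\<And>j b. bij_betw (e j b) {0..<card (Q j b)} (Q j b)" by metis
  \<comment> \<open>Each colour of class \<open>j\<close> occupies at least 2^(j-1) of the at most
    2^(s+1) positions of the block.\<close>
  have cardQ: "card (Q j b) \<le> min k (2 ^ (Suc (Suc s) - j))" if j: "j \<in> {1..Suc (Suc s)}" for j b
  proof (rule min.boundedI)
    have "card (Q j b) \<le> card {1..k}" by (rule card_mono) (auto simp: Q_def)
    then show "card (Q j b) \<le> k" by simp
    have "of_nat (card (Q j b)) * 2 ^ (j - 1) \<le> (\<Sum>c\<in>Q j b. a (b, c))"
      by (rule sum_bounded_below) (simp add: Q_def)
    also have "\<dots> = (\<Sum>c\<in>Q j b. card {i \<in> {1..n}. i div 2 ^ Suc s = b \<and> z0 i = c})"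
      unfolding known[OF z0, symmetric] color_count_def by simp
    also have "\<dots> = card (\<Union>c\<in>Q j b. {i \<in> {1..n}. i div 2 ^ Suc s = b \<and> z0 i = c})"
      by (rule card_UN_disjoint[symmetric]) (auto simp: finQ)
    also have "\<dots> \<le> card {i \<in> {1..n}. i div 2 ^ Suc s = b}"
      by (rule card_mono) auto
    also have "\<dots> \<le> 2 ^ Suc s" by (rule card_block_le)
    also have "\<dots> = 2 ^ (Suc (Suc s) - j) * 2 ^ (j - 1)"
      using j by (subst power_add[symmetric]) auto
    finally show "card (Q j b) \<le> 2 ^ (Suc (Suc s) - j)" by simp
  qed
  \<comment> \<open>Blocks with at most \<open>r\<close> colours of class \<open>j\<close>
    contribute no positions. Their unknown is 0, so one range of ranks serves all blocks.\<close>
  define V where "V = (\<lambda>(j, r). {i \<in> {1..n}. even (i div 2 ^ s) \<and> r < card (Q j (i div 2 ^ Suc s))})"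
  define cnt where "cnt = (\<lambda>p z b. card {i \<in> V p. i div 2 ^ Suc s = b \<and> z i = e (fst p) b (snd p)})"
  define J where "J = Sigma {1..Suc (Suc s)} (\<lambda>j. {..<min k (2 ^ (Suc (Suc s) - j))})"
  have e_in: "e j b r \<in> Q j b" if "r < card (Q j b)" for j b r
    using bij_betwE[OF e[of j b]] that by auto
  have cnt_lt: "cnt (j, r) z b < 2 ^ j" if "z \<in> Z" for j r z b
  proof (cases "r < card (Q j b)")
    case True
    have "cnt (j, r) z b \<le> color_count n (Suc s) z (b, e j b r)"
      unfolding cnt_def color_count_def V_def by (auto intro!: card_mono)
    also have "\<dots> < 2 ^ j" using e_in[OF True] known[OF that] by (auto simp: Q_def)
    finally show ?thesis .
  next
    case False
    then have "{i \<in> V (j, r). i div 2 ^ Suc s = b \<and> z i = e j b r} = {}" by (auto simp: V_def)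
    then show ?thesis unfolding cnt_def fst_conv snd_conv by (simp only: card.empty) simp
  qed
  have "determines n k (\<Sum>p\<in>J. detect_cost (fst p) B) Z (color_count n s)"
  proof (rule determines_family[where g = "\<lambda>p z. \<lambda>b\<in>{..<B}. cnt p z b"])
    show "finite J" unfolding J_def by auto
    show "determines n k (detect_cost (fst p) B) Z (\<lambda>z. \<lambda>b\<in>{..<B}. cnt p z b)" if "p \<in> J" for p
    proof (rule determines_detect[where v = "\<lambda>z b. int (cnt p z b)"])
      show "fst p > 0" "B > 0" "k \<ge> 1" using that k by (auto simp: J_def B_def)
      show "\<bar>int (cnt p z b) - int (cnt p z' b)\<bar> < 2 ^ fst p" if "z \<in> Z" "z' \<in> Z" for z z' b
      proof -
        have "int (cnt p z b) < 2 ^ fst p" "int (cnt p z' b) < 2 ^ fst p"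
          using cnt_lt[of _ "fst p" "snd p" b] that by (simp_all flip: of_nat_power add: of_nat_less_iff[where 'a=int])
        then show ?thesis by linarith
      qed
      show "(\<lambda>b\<in>{..<B}. cnt p z b) = (\<lambda>b\<in>{..<B}. cnt p z' b)"
        if "\<And>b. b < B \<Longrightarrow> int (cnt p z b) = int (cnt p z' b)" for z z'
        using that by (intro restrict_ext) auto
      show "determines n k 1 Z (\<lambda>z. \<Sum>b\<in>R. int (cnt p z b))" if R: "R \<subseteq> {..<B}" for R
      proof -
        define P where "P = {i \<in> V p. i div 2 ^ Suc s \<in> R}"
        define x where "x i = e (fst p) (i div 2 ^ Suc s) (snd p)" for i
        have "determines n k 1 Z (\<lambda>z. int (card {i \<in> P. z i = x i}))"
        proof (rule determines_blank_query[OF k])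
          show "z i = 1 \<longleftrightarrow> z' i = 1" if "z \<in> Z" "z' \<in> Z" "i \<in> {1..n}" for z z' i
            using that by (rule blank)
          show "P \<subseteq> {1..n}" by (auto simp: P_def V_def split: prod.splits)
          show "x i \<in> {1..k}" if "i \<in> P" for i
            using that e_in[of "snd p" "fst p" "i div 2 ^ Suc s"] by (auto simp: P_def V_def x_def Q_def split: prod.splits)
        qed
        moreover have "int (card {i \<in> P. z i = x i}) = (\<Sum>b\<in>R. int (cnt p z b))" for z
        proof -
          have "{i \<in> P. z i = x i} = (\<Union>b\<in>R. {i \<in> V p. i div 2 ^ Suc s = b \<and> z i = e (fst p) b (snd p)})"
            by (auto simp: P_def x_def)
          also have "card \<dots> = (\<Sum>b\<in>R. cnt p z b)"
            unfolding cnt_def using R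
            by (intro card_UN_disjoint) (auto intro: finite_subset simp: V_def split: prod.splits)
          finally show ?thesis by simp
        qed
        ultimately show ?thesis by simp
      qed
    qed
    fix z z' assume z: "z \<in> Z" "z' \<in> Z"
      and eq: "\<And>p. p \<in> J \<Longrightarrow> (\<lambda>b\<in>{..<B}. cnt p z b) = (\<lambda>b\<in>{..<B}. cnt p z' b)"
    have left: "color_count n s z (2 * b, c) = color_count n s z' (2 * b, c)" for b c
    \<comment> \<open>A colour absent from the block lies in no class, but its counts in both halves
      are already known to be 0.\<close>
    proof (cases "a (b, c) = 0")
      case True
      then show ?thesis
        using color_count_Suc[of n s z b c] color_count_Suc[of n s z' b c] known[OF z(1)] known[OF z(2)] by simp
    next
      case False
      then have pos: "a (b, c) \<ge> 1" by simp
      have "color_count n (Suc s) z (b, c) \<noteq> 0" using False known[OF z(1)] by simp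
      then obtain i where i: "i \<in> {1..n}" "i div 2 ^ Suc s = b" "z i = c"
        unfolding color_count_def by (auto simp: card_eq_0_iff)
      then have b: "b < B" using div_lt by blast
      have c: "c \<in> {1..k}"
        using i z(1) Z PiE_mem[of z "{1..n}" "\<lambda>_. {1..k}" i] unfolding codes_def by blast
      obtain m where m: "2 ^ m \<le> a (b, c)" "a (b, c) < 2 ^ (m + 1)"
        using ex_power_ivl1[of 2 "a (b, c)"] pos by auto
      have "a (b, c) \<le> 2 ^ Suc s"
      proof -
        have "a (b, c) \<le> card {i \<in> {1..n}. i div 2 ^ Suc s = b}"
          unfolding known[OF z0, symmetric] color_count_def by (auto intro!: card_mono)
        then show ?thesis using card_block_le by (rule order_trans)
      qed
      then have "(2::nat) ^ m \<le> 2 ^ Suc s" using m by linarith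
      then have j: "Suc m \<in> {1..Suc (Suc s)}" using power_le_imp_le_exp[of "2::nat" m "Suc s"] by simp
      have "c \<in> Q (Suc m) b" using c m by (simp add: Q_def)
      then obtain r where r: "r < card (Q (Suc m) b)" "e (Suc m) b r = c"
        using e[of "Suc m" b] by (metis atLeastLessThan_iff bij_betw_def imageE)
      have "(Suc m, r) \<in> J" using j r cardQ[OF j, of b] by (auto simp: J_def)
      from fun_cong[OF eq[OF this], of b] have "cnt (Suc m, r) z b = cnt (Suc m, r) z' b" using b by simp
      moreover have "cnt (Suc m, r) y b = color_count n s y (2 * b, c)" for y
      proof -
        have "{i \<in> V (Suc m, r). i div 2 ^ Suc s = b \<and> y i = c} = {i \<in> {1..n}. i div 2 ^ s = 2 * b \<and> y i = c}"
          using r(1) unfolding V_def half by auto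
        then show ?thesis unfolding cnt_def color_count_def using r(2) by simp
      qed
      ultimately show ?thesis by simp
    qed
    show "color_count n s z = color_count n s z'"
    proof
      fix p :: "nat \<times> nat"
      obtain b c where p: "p = (b, c)" by (cases p)
      show "color_count n s z p = color_count n s z' p"
      proof (cases "even b")
        case True
        then show ?thesis using left[of "b div 2" c] p by simp
      next
        case False
        then have "2 * (b div 2) + 1 = b" by simp
        then show ?thesis
          using left[of "b div 2" c] color_count_Suc[of n s z "b div 2" c] color_count_Suc[of n s z' "b div 2" c]
            known[OF z(1)] known[OF z(2)] p by simp
      qed
    qed
  qed
  moreover have "(\<Sum>p\<in>J. detect_cost (fst p) B) = level_cost n k (Suc s)"
    using sum.Sigma[of "{1..Suc (Suc s)}" "\<lambda>j. {..<min k (2 ^ (Suc (Suc s) - j))}" "\<lambda>j r. detect_cost j B"]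
    by (simp add: J_def level_cost_def B_def split_def)
  ultimately show ?thesis by simp
qed

section \<open>Colour totals and the first blank\<close>

lemma determines_monochromatic:
  assumes "k \<ge> 1"
  shows "determines n k k (codes n k) (\<lambda>z c. card {i \<in> {1..n}. z i = c})"
proof -
  have "determines n k (\<Sum>c\<in>{1..k}. 1) (codes n k) (\<lambda>z c. card {i \<in> {1..n}. z i = c})"
  proof (rule determines_family[where g = "\<lambda>c z. card {i \<in> {1..n}. z i = c}"])
    show "determines n k 1 (codes n k) (\<lambda>z. card {i \<in> {1..n}. z i = c})" if c: "c \<in> {1..k}" for c
    proof (rule determines_query)
      show "(\<lambda>i\<in>{1..n}. c) \<in> codes n k" using c by (auto simp: codes_def)
      have "eq_pegs n z (\<lambda>i\<in>{1..n}. c) = card {i \<in> {1..n}. z i = c}" for z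
        unfolding eq_pegs_def by (intro arg_cong[of _ _ card]) auto
      then show "card {i \<in> {1..n}. z i = c} = card {i \<in> {1..n}. z' i = c}"
        if "eq_pegs n z (\<lambda>i\<in>{1..n}. c) = eq_pegs n z' (\<lambda>i\<in>{1..n}. c)" for z z'
        using that by simp
    qed
    fix z z' assume z: "z \<in> codes n k" "z' \<in> codes n k"
      and eq: "\<And>c. c \<in> {1..k} \<Longrightarrow> card {i \<in> {1..n}. z i = c} = card {i \<in> {1..n}. z' i = c}"
    show "(\<lambda>c. card {i \<in> {1..n}. z i = c}) = (\<lambda>c. card {i \<in> {1..n}. z' i = c})"
    proof
      fix c
      show "card {i \<in> {1..n}. z i = c} = card {i \<in> {1..n}. z' i = c}"
      proof (cases "c \<in> {1..k}")
        case False
        then have "{i \<in> {1..n}. y i = c} = {}" if "y \<in> codes n k" for y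
          using that PiE_mem[of y "{1..n}" "\<lambda>_. {1..k}"] unfolding codes_def by blast
        with z show ?thesis by (simp only:)
      qed (rule eq)
    qed
  qed simp
  then show ?thesis by simp
qed

text \<open>
  No blank is available yet. Guessing colour 1 on a set of positions and colour 2 elsewhere yields the
  difference of the two colour counts on that set, so both colours are located together.
\<close>

lemma determines_blank:
  assumes "k \<ge> 2" "n > 0"
    and total: "\<And>z. z \<in> Z \<Longrightarrow> card {i \<in> {1..n}. z i = 2} = m"
  shows "determines n k (detect_cost 2 n) Z (\<lambda>z. {i \<in> {1..n}. z i = 1})"
\<comment> \<open>The weighed values are -1, 0 or 1, so two of them differ by at most 2 < 2^2; hence
  the parameter 2 in the cost.\<close>
proof (rule determines_detect[where v = "\<lambda>z b. of_bool (z (Suc b) = 1) - of_bool (z (Suc b) = 2)"])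
  show "\<bar>(of_bool (z (Suc b) = 1) - of_bool (z (Suc b) = 2)) -
      (of_bool (z' (Suc b) = 1) - of_bool (z' (Suc b) = (2::nat)))\<bar> < (2::int) ^ 2" for z z' :: "nat \<Rightarrow> nat" and b
    by (simp add: of_bool_def)
  show "{i \<in> {1..n}. z i = 1} = {i \<in> {1..n}. z' i = 1}"
    if eq: "\<And>b. b < n \<Longrightarrow> of_bool (z (Suc b) = 1) - of_bool (z (Suc b) = 2) =
      (of_bool (z' (Suc b) = 1) - of_bool (z' (Suc b) = 2) :: int)" for z z' :: "nat \<Rightarrow> nat"
  proof -
    have "z i = 1 \<longleftrightarrow> z' i = 1" if "i \<in> {1..n}" for i
    proof -
      have "i - 1 < n" "Suc (i - 1) = i" using that by auto
      with eq[of "i - 1"] show ?thesis by (auto simp: of_bool_def split: if_splits)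
    qed
    then show ?thesis by blast
  qed
  show "determines n k 1 Z (\<lambda>z. \<Sum>b\<in>R. of_bool (z (Suc b) = 1) - (of_bool (z (Suc b) = 2) :: int))"
    if R: "R \<subseteq> {..<n}" for R
  proof (rule determines_query)
    define P where "P = Suc ` R"
    have P: "P \<subseteq> {1..n}" "finite P" using R by (auto simp: P_def intro: finite_subset)
    let ?x = "\<lambda>i\<in>{1..n}. if i \<in> P then 1 else 2"
    show "?x \<in> codes n k" using assms(1) by (auto simp: codes_def)
    \<comment> \<open>The answer counts colour 1 inside \<open>P\<close> and colour 2 outside. The
      latter is \<open>m\<close> minus the count of colour 2 inside \<open>P\<close>.\<close>
    have val: "(\<Sum>b\<in>R. of_bool (z (Suc b) = 1) - of_bool (z (Suc b) = 2)) = int (eq_pegs n z ?x) - int m"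
      if z: "z \<in> Z" for z
    proof -
      have "(\<Sum>b\<in>R. of_bool (z (Suc b) = 1) - of_bool (z (Suc b) = 2)) =
          (\<Sum>i\<in>P. of_bool (z i = 1) - (of_bool (z i = 2) :: int))"
        unfolding P_def by (subst sum.reindex) auto
      also have "\<dots> = int (card {i \<in> P. z i = 1}) - int (card {i \<in> P. z i = 2})"
        using P(2) by (simp add: sum_subtractf of_bool_def flip: sum.inter_filter)
      finally have "(\<Sum>b\<in>R. of_bool (z (Suc b) = 1) - of_bool (z (Suc b) = 2)) =
          int (card {i \<in> P. z i = 1}) - int (card {i \<in> P. z i = 2})" .
      moreover have "m = card {i \<in> P. z i = 2} + card {i \<in> {1..n} - P. z i = 2}"
      proof -
        have "{i \<in> {1..n}. z i = 2} = {i \<in> P. z i = 2} \<union> {i \<in> {1..n} - P. z i = 2}" using P by auto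
        then show ?thesis unfolding total[OF z, symmetric]
          using P(2) by (simp only:) (rule card_Un_disjoint, auto)
      qed
      ultimately show ?thesis unfolding eq_pegs_if[OF P(1)] by simp
    qed
    show "(\<Sum>b\<in>R. of_bool (z (Suc b) = 1) - of_bool (z (Suc b) = 2)) =
       (\<Sum>b\<in>R. of_bool (z' (Suc b) = 1) - (of_bool (z' (Suc b) = 2) :: int))"
      if "z \<in> Z" "z' \<in> Z" "eq_pegs n z ?x = eq_pegs n z' ?x" for z z'
      using that by (simp only: val)
  qed
qed (use assms in auto)

lemma color_count_top:
  assumes "n < 2 ^ s"
  shows "color_count n s z = (\<lambda>(b, c). if b = 0 then card {i \<in> {1..n}. z i = c} else 0)"
proof -
  have "i div 2 ^ s = 0" if "i \<in> {1..n}" for i using that assms by simp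
  then have "{i \<in> {1..n}. i div 2 ^ s = b \<and> z i = c} = (if b = 0 then {i \<in> {1..n}. z i = c} else {})" for b c
    by auto
  then show ?thesis unfolding color_count_def by (auto simp: fun_eq_iff)
qed

lemma color_count_0:
  assumes "z \<in> codes n k" "z' \<in> codes n k" "color_count n 0 z = color_count n 0 z'"
  shows "z = z'"
proof (rule PiE_ext)
  show "z \<in> {1..n} \<rightarrow>\<^sub>E {1..k}" "z' \<in> {1..n} \<rightarrow>\<^sub>E {1..k}" using assms by (simp_all add: codes_def)
  fix i assume i: "i \<in> {1..n}"
  have "card {i' \<in> {1..n}. i' = i \<and> z' i' = z i} = card {i' \<in> {1..n}. i' = i \<and> z i' = z i}"
    using fun_cong[OF assms(3), of "(i, z i)"] unfolding color_count_def by simp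
  moreover have "{i' \<in> {1..n}. i' = i \<and> z i' = z i} = {i}" using i by auto
  ultimately have "{i' \<in> {1..n}. i' = i \<and> z' i' = z i} \<noteq> {}" by (metis card.empty card_1_singleton_iff One_nat_def zero_neq_one)
  then show "z i = z' i" by auto
qed

definition total_cost :: "nat \<Rightarrow> nat \<Rightarrow> nat \<Rightarrow> nat" where
  "total_cost n k t = k + detect_cost 2 n + (\<Sum>s\<in>{1..t}. level_cost n k s)"

lemma determines_code:
  assumes k: "k \<ge> 2" and n: "n > 0" and t: "n < 2 ^ t"
  shows "determines n k (total_cost n k t) (codes n k) id"
proof -
  \<comment> \<open>The positions of colour 1 are carried along with the counts, so that the blank
    is known on every fibre of \<open>h\<close>. At level \<open>t\<close> all positions lie in
    block 0, whose counts are the colour totals; at level 0 blocks are single positions.\<close>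
  define h where "h s z = (color_count n s z, {i \<in> {1..n}. z i = 1})" for s and z :: "nat \<Rightarrow> nat"
  have k1: "k \<ge> 1" using k by simp
  have top: "determines n k (k + detect_cost 2 n) (codes n k) (h t)"
  proof (rule determines_compose[OF determines_monochromatic[OF k1]])
    fix v
    let ?Z = "{z \<in> codes n k. (\<lambda>c. card {i \<in> {1..n}. z i = c}) = v}"
    have v: "card {i \<in> {1..n}. z i = c} = v c" if "z \<in> ?Z" for z c
      using that fun_cong[of "\<lambda>c. card {i \<in> {1..n}. z i = c}" v c] by simp
    have "determines n k (detect_cost 2 n) ?Z (\<lambda>z. {i \<in> {1..n}. z i = 1})"
      by (rule determines_blank[OF k n v])
    then show "determines n k (detect_cost 2 n) ?Z (h t)"
    proof (rule determines_factor)
      fix z z' assume z: "z \<in> ?Z" "z' \<in> ?Z" and eq: "{i \<in> {1..n}. z i = 1} = {i \<in> {1..n}. z' i = 1}"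
      show "h t z = h t z'"
        unfolding h_def color_count_top[OF t] v[OF z(1)] v[OF z(2)] using eq by (simp only:)
    qed
  qed
  have "determines n k (k + detect_cost 2 n + (\<Sum>s\<in>{Suc (t - d)..t}. level_cost n k s)) (codes n k) (h (t - d))"
    if "d \<le> t" for d
    using that
  proof (induction d)
    case 0
    then show ?case using top by simp
  next
    case (Suc d)
    define s where "s = t - Suc d"
    have s: "t - d = Suc s" using Suc.prems by (simp add: s_def)
    have "determines n k (k + detect_cost 2 n + (\<Sum>s\<in>{Suc (Suc s)..t}. level_cost n k s) + level_cost n k (Suc s))
      (codes n k) (h s)"
    proof (rule determines_compose)
      show "determines n k (k + detect_cost 2 n + (\<Sum>s\<in>{Suc (Suc s)..t}. level_cost n k s)) (codes n k) (h (Suc s))"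
        using Suc s by simp
      fix v
      let ?Z = "{z \<in> codes n k. h (Suc s) z = v}"
      have blank: "{i \<in> {1..n}. z i = 1} = snd v" if "z \<in> ?Z" for z using that by (auto simp: h_def)
      have "determines n k (level_cost n k (Suc s)) ?Z (color_count n s)"
      proof (rule determines_refine[OF k1])
        show "z i = 1 \<longleftrightarrow> z' i = 1" if "z \<in> ?Z" "z' \<in> ?Z" "i \<in> {1..n}" for z z' i
          using blank[OF that(1)] blank[OF that(2)] that(3) by blast
        show "color_count n (Suc s) z = fst v" if "z \<in> ?Z" for z using that by (auto simp: h_def)
      qed auto
      then show "determines n k (level_cost n k (Suc s)) ?Z (h s)"
      proof (rule determines_factor)
        fix z z' assume z: "z \<in> ?Z" "z' \<in> ?Z" and eq: "color_count n s z = color_count n s z'"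
        show "h s z = h s z'" unfolding h_def blank[OF z(1)] blank[OF z(2)] eq ..
      qed
    qed
    moreover have "(\<Sum>s\<in>{Suc s..t}. level_cost n k s) = (\<Sum>s\<in>{Suc (Suc s)..t}. level_cost n k s) + level_cost n k (Suc s)"
      using s Suc.prems by (subst sum.atLeast_Suc_atMost) auto
    ultimately show ?case unfolding s_def[symmetric] by (simp add: add.assoc)
  qed
  from this[of t] have "determines n k (total_cost n k t) (codes n k) (h 0)"
    by (simp add: total_cost_def)
  then show ?thesis
    by (rule determines_factor) (use color_count_0 in \<open>auto simp: h_def\<close>)
qed

section \<open>The number of guesses\<close>

lemma detect_cost_le: "real (detect_cost j B) \<le> 16 * real j * real B / log 2 (real B + 1)"
proof -
  have "0 \<le> 16 * real j * real B / log 2 (real B + 1)" by simp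
  then show ?thesis unfolding detect_cost_def by (rule of_nat_floor)
qed

text \<open>Levels reach slightly beyond log n, up to 2^s \<le> 2n. Then the added block costs 1
  \<le> 2n / 2^s, whence 48 = 16 * 3, and log n - s may be negative, whence the maximum with
  1.\<close>

lemma detect_cost_block_le:
  assumes n: "n > 0" and s: "2 ^ s \<le> 2 * n"
  shows "real (detect_cost j (n div 2 ^ s + 1)) \<le> real j * (48 * real n / (2 ^ s * max 1 (log 2 (real n) - real s)))"
proof -
  define B where "B = n div 2 ^ s + 1"
  have "real (n div 2 ^ s) \<le> real n / 2 ^ s" using of_nat_div_le_of_nat[of n "2 ^ s", where 'a = real] by simp
  moreover have "real (2 ^ s) \<le> real (2 * n)" using s by (simp only: of_nat_le_iff)
  ultimately have B1: "real B \<le> 3 * real n / 2 ^ s"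
    unfolding B_def by (simp add: field_simps)
  have "n < 2 ^ s * B" unfolding B_def using dividend_less_times_div[of "2 ^ s" n] by simp
  then have "real n < real (2 ^ s * B)" by (simp only: of_nat_less_iff)
  then have "real n < 2 ^ s * real B" by simp
  then have "real n / 2 ^ s \<le> real B + 1" by (simp add: field_simps add_increasing)
  then have "log 2 (real n / 2 ^ s) \<le> log 2 (real B + 1)" using n by simp
  moreover have "log 2 (real n / 2 ^ s) = log 2 (real n) - real s"
    using n by (simp add: log_divide)
  moreover have "1 \<le> log 2 (real B + 1)" unfolding B_def by simp
  ultimately have m: "max 1 (log 2 (real n) - real s) \<le> log 2 (real B + 1)" by simp
  have "real (detect_cost j B) \<le> 16 * real j * real B / log 2 (real B + 1)" by (rule detect_cost_le)
  also have "\<dots> \<le> 16 * real j * (3 * real n / 2 ^ s) / max 1 (log 2 (real n) - real s)"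
    using m B1 by (intro frac_le mult_left_mono) auto
  finally show ?thesis unfolding B_def by (simp add: field_simps)
qed

text \<open>The infinite series has the value 1 / (1 - 3/4)^2 = 16; the partial sums are given
  exactly for the induction.\<close>

lemma sum_linear_geometric: "(\<Sum>j<m. real (Suc j) * (3/4) ^ j) \<le> 16"
proof -
  have "(\<Sum>j<m. real (Suc j) * (3/4) ^ j) = 16 - (4 * real m + 16) * (3/4) ^ m"
    by (induction m) (simp_all add: algebra_simps add_divide_distrib)
  also have "\<dots> \<le> 16" by simp
  finally show ?thesis .
qed

text \<open>Relative to 2^s, the number of colours in a class is at most 2^(-j) by block size and,
  above level \<open>S\<close>, at most 2^(-e) by \<open>k\<close>. The geometric mean keeps decay
  in both exponents; 3/4 is a rational bound for the square root of 1/2. Decay in \<open>j\<close>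
  absorbs the factor j, decay in \<open>e\<close> remains for the sum over levels. The constant is
  768 = 48 * 16.\<close>

lemma level_cost_le:
  assumes n: "n > 0" and s: "2 ^ s \<le> 2 * n" and S: "s \<le> S \<or> k < 2 ^ Suc S"
  shows "real (level_cost n k s) \<le> 768 * real n * ((3/4) ^ (s - Suc S) / max 1 (log 2 (real n) - real s))"
proof -
  define e where "e = s - Suc S"
  define c where "c = 48 * real n / (2 ^ s * max 1 (log 2 (real n) - real s))"
  have c: "c \<ge> 0" unfolding c_def by simp
  have u: "real (min k (2 ^ (s - j))) \<le> 2 ^ s * ((3/4) ^ e * (3/4) ^ j)" if "j \<le> s" for j
  proof -
    define u where "u = real (min k (2 ^ (s - j))) / 2 ^ s"
    have "real (min k (2 ^ (s - j))) \<le> 2 ^ (s - j)"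
      by (metis min.cobounded2 of_nat_le_iff of_nat_numeral of_nat_power)
    then have uj: "u \<le> (1/2) ^ j"
      using that unfolding u_def by (simp add: power_diff field_simps)
    have ue: "u \<le> (1/2) ^ e"
    proof (cases "s \<le> S")
      case True
      then show ?thesis using uj power_le_one[of "1/2 :: real" j] unfolding e_def by simp
    next
      case False
      then have "real k \<le> 2 ^ Suc S" using S
        by (metis less_imp_le of_nat_le_iff of_nat_numeral of_nat_power)
      moreover have "(2::real) ^ s = 2 ^ Suc S * 2 ^ e"
        using False unfolding e_def power_add[symmetric] by simp
      moreover have "u \<le> real k / 2 ^ s" unfolding u_def by (intro divide_right_mono) auto
      ultimately have "u \<le> 2 ^ Suc S / (2 ^ Suc S * 2 ^ e)"
        by (metis divide_right_mono order_trans zero_le_power zero_le_numeral)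
      then show ?thesis by (simp add: power_one_over)
    qed
    have "u\<^sup>2 \<le> (1/2) ^ e * (1/2) ^ j"
      unfolding power2_eq_square using uj ue by (intro mult_mono) (auto simp: u_def)
    also have "\<dots> \<le> (9/16) ^ e * (9/16) ^ j"
      by (intro mult_mono power_mono) auto
    also have "\<dots> = ((3/4) ^ e * (3/4) ^ j)\<^sup>2"
      by (simp add: power_mult_distrib power2_eq_square mult_ac flip: power_mult_distrib)
    finally have "u \<le> (3/4) ^ e * (3/4) ^ j" by (rule power2_le_imp_le) simp
    then show ?thesis unfolding u_def by (simp add: field_simps)
  qed
  have "real (level_cost n k s) = (\<Sum>j\<in>{1..Suc s}. real (min k (2 ^ (Suc s - j))) * real (detect_cost j (n div 2 ^ s + 1)))"
    unfolding level_cost_def by simp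
  also have "\<dots> \<le> (\<Sum>j\<in>{1..Suc s}. 2 ^ s * ((3/4) ^ e * (3/4) ^ (j - 1)) * (real j * c))"
  proof (intro sum_mono mult_mono)
    fix j assume j: "j \<in> {1..Suc s}"
    then have j': "Suc s - j = s - (j - 1)" "j - 1 \<le> s" by auto
    show "real (min k (2 ^ (Suc s - j))) \<le> 2 ^ s * ((3/4) ^ e * (3/4) ^ (j - 1))"
      unfolding j'(1) by (rule u[OF j'(2)])
    show "real (detect_cost j (n div 2 ^ s + 1)) \<le> real j * c"
      unfolding c_def by (rule detect_cost_block_le[OF n s])
  qed auto
  also have "\<dots> = 2 ^ s * (3/4) ^ e * c * (\<Sum>j\<in>{1..Suc s}. real j * (3/4) ^ (j - 1))"
    by (simp only: sum_distrib_left mult_ac)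
  also have "(\<Sum>j\<in>{1..Suc s}. real j * (3/4) ^ (j - 1)) = (\<Sum>j<Suc s. real (Suc j) * (3/4) ^ j)"
    by (rule sum.reindex_bij_witness[of _ Suc "\<lambda>j. j - 1"]) auto
  also have "2 ^ s * (3/4) ^ e * c * \<dots> \<le> 2 ^ s * (3/4) ^ e * c * 16"
    using c by (intro mult_left_mono sum_linear_geometric) auto
  also have "\<dots> = 768 * real n * ((3/4) ^ e / max 1 (log 2 (real n) - real s))"
    unfolding c_def by simp
  finally show ?thesis unfolding e_def .
qed

text \<open>Comparison with the integral of 1 / (x - s): the interval from s to s + 1 pays for term
  s. The last term has no interval left and stays as 1 / (x - S).\<close>

lemma sum_reciprocal_le_ln:
  fixes x :: real
  assumes "real S < x"
  shows "(\<Sum>s\<in>{1..S}. 1 / max 1 (x - real s)) \<le> 1 / (x - real S) + ln (x / (x - real S))"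
  using assms
proof (induction S)
  case (Suc S)
  define y where "y = x - real S"
  have y: "y > 1" using Suc.prems by (simp add: y_def)
  have "ln ((y - 1) / y) \<le> (y - 1) / y - 1" using y by (intro ln_le_minus_one) auto
  also have "\<dots> = - 1 / y" using y by (simp add: field_simps)
  finally have l: "1 / y + ln (y - 1) \<le> ln y" using y by (simp add: ln_div)
  have "(\<Sum>s\<in>{1..Suc S}. 1 / max 1 (x - real s)) \<le> 1 / y + ln (x / y) + 1 / max 1 (y - 1)"
    using Suc.IH Suc.prems by (simp add: y_def algebra_simps)
  also have "1 / max 1 (y - 1) \<le> 1 / (y - 1)" using y by (intro divide_left_mono) auto
  also have "1 / y + ln (x / y) \<le> ln (x / (y - 1))"
    using l y Suc.prems by (simp add: ln_div)
  finally show ?case by (simp add: y_def algebra_simps)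
qed simp

lemma sum_damped_reciprocal_le:
  fixes x :: real
  assumes S: "real S < x"
  shows "(\<Sum>s\<in>{1..t}. (3/4) ^ (s - Suc S) / max 1 (x - real s)) \<le> 21 / (x - real S) + ln (x / (x - real S))"
proof -
  define y where "y = x - real S"
  have y: "y > 0" using S by (simp add: y_def)
  let ?f = "\<lambda>s. (3/4) ^ (s - Suc S) / max 1 (x - real s)"
  \<comment> \<open>The range is enlarged so that it can be cut at \<open>S\<close> even if
    \<open>t\<close> is smaller.\<close>
  have "sum ?f {1..t} \<le> sum ?f {1..S + t}" by (rule sum_mono2) auto
  also have "\<dots> = sum ?f {1..S} + sum ?f {Suc S..S + t}"
    by (subst sum.union_disjoint[symmetric]) (auto intro!: sum.cong)
  also have "sum ?f {1..S} = (\<Sum>s\<in>{1..S}. 1 / max 1 (x - real s))" by (intro sum.cong) auto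
  also have "\<dots> \<le> 1 / y + ln (x / y)" unfolding y_def by (rule sum_reciprocal_le_ln[OF S])
  also have "sum ?f {Suc S..S + t} = (\<Sum>e<t. ?f (Suc (S + e)))"
    by (rule sum.reindex_bij_witness[of _ "\<lambda>e. Suc (S + e)" "\<lambda>s. s - Suc S"]) auto
  also have "\<dots> \<le> (\<Sum>e<t. (real (Suc e) * (3/4) ^ e + (3/4) ^ e) / y)"
  proof (rule sum_mono)
    fix e
    define d where "d = real (Suc e)"
    have d: "d \<ge> 1" by (simp add: d_def)
    \<comment> \<open>Moving d levels beyond \<open>S\<close> increases the reciprocal by at most
      the factor d + 1, which the powers of 3/4 outweigh. These levels give (16 + 4) / y; with the
      boundary term 1 / y this makes 21.\<close>
    have "y \<le> (d + 1) * max 1 (y - d)"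
    proof (cases "y - d \<le> 1")
      case False
      then have "0 \<le> d * (y - d - 1)" using d by (intro mult_nonneg_nonneg) auto
      then show ?thesis using False by (simp add: max_def algebra_simps)
    qed (simp add: max_def)
    then have "1 / max 1 (y - d) \<le> (d + 1) / y" using y by (simp add: field_simps)
    then have "(3/4) ^ e * (1 / max 1 (y - d)) \<le> (3/4) ^ e * ((d + 1) / y)" by (intro mult_left_mono) auto
    moreover have "x - real (Suc (S + e)) = y - d" by (simp add: y_def d_def)
    ultimately show "?f (Suc (S + e)) \<le> (real (Suc e) * (3/4) ^ e + (3/4) ^ e) / y"
      by (simp add: d_def algebra_simps)
  qed
  also have "\<dots> = ((\<Sum>e<t. real (Suc e) * (3/4) ^ e) + (\<Sum>e<t. (3/4) ^ e)) / y"
    by (simp add: sum.distrib add_divide_distrib flip: sum_divide_distrib)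
  also have "\<dots> \<le> (16 + 4) / y"
  proof -
    have "(\<Sum>e<t. (3/4 :: real) ^ e) \<le> 4" by (subst sum_gp_strict) (simp add: field_simps)
    then show ?thesis using y sum_linear_geometric[of t] by (intro divide_right_mono add_mono) auto
  qed
  finally show ?thesis using y by (simp add: y_def field_simps)
qed

section \<open>The total cost in the two ranges of \<open>k\<close>\<close>

lemma ln_le_log2: "x \<ge> 1 \<Longrightarrow> ln x \<le> log 2 (x :: real)"
  using mult_left_mono[OF less_imp_le[OF ln_2_less_1], of "ln x"] by (simp add: log_def field_simps)

lemma exists_binary_length:
  assumes "n > 0"
  obtains m where "2 ^ m \<le> n" "n < 2 ^ Suc m" "real m \<le> log 2 (real n)" "log 2 (real n) < real m + 1"
proof -
  obtain m where m: "2 ^ m \<le> n" "n < 2 ^ (m + 1)" using ex_power_ivl1[of 2 n] assms by auto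
  have "real (2 ^ m) \<le> real n" "real n < real (2 ^ (m + 1))" using m by (simp_all only: of_nat_le_iff of_nat_less_iff)
  then have "2 powr real m \<le> real n" "real n < 2 powr real (m + 1)" by (simp_all only: powr_realpow of_nat_power of_nat_numeral zero_less_numeral)
  then have "real m \<le> log 2 (real n)" "log 2 (real n) < real (m + 1)"
    using assms by (simp_all only: le_log_iff log_less_iff of_nat_0_less_iff one_less_numeral_iff semiring_norm)
  then show thesis using m by (intro that[of m]) auto
qed

lemma detect_cost_2_le:
  assumes "n \<ge> 2" shows "real (detect_cost 2 n) \<le> 32 * real n / log 2 (real n)"
proof -
  have "real (detect_cost 2 n) \<le> 16 * real 2 * real n / log 2 (real n + 1)" by (rule detect_cost_le)
  also have "\<dots> \<le> 16 * real 2 * real n / log 2 (real n)"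
    using assms by (intro divide_left_mono mult_pos_pos) auto
  finally show ?thesis by simp
qed

lemma total_cost_many_colors:
  assumes n: "n \<ge> 4"
  shows "\<exists>t. n < 2 ^ t \<and> real (total_cost n k t) + 1 \<le> 4000 * (real n * log 2 (log 2 (real n)) + real k)"
proof -
  define x where "x = log 2 (real n)"
  obtain m where m: "2 ^ m \<le> n" "n < 2 ^ Suc m" "real m \<le> x" "x < real m + 1"
    unfolding x_def by (rule exists_binary_length[of n]) (use n in auto)
  have x: "x \<ge> 2" using n unfolding x_def by (subst le_log_iff) auto
  then have "m \<ge> 1" using m(4) by linarith
  \<comment> \<open>Up to level \<open>m - 1\<close> the difference x - s is at least 1 and the
    logarithmic estimate applies. The two last levels \<open>m\<close> and \<open>m + 1\<close> are
    bounded by 1 each.\<close>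
  then obtain S where S: "m = Suc S" by (cases m) auto
  have lx: "log 2 x \<ge> 1" using x by simp
  have "(\<Sum>s\<in>{1..Suc m}. real (level_cost n k s)) \<le> (\<Sum>s\<in>{1..Suc m}. 768 * real n * (1 / max 1 (x - real s)))"
  proof (rule sum_mono)
    fix s assume s: "s \<in> {1..Suc m}"
    then have "(2::nat) ^ s \<le> 2 ^ Suc m" by (intro power_increasing) auto
    then have "2 ^ s \<le> 2 * n" using m(1) by simp
    from level_cost_le[OF _ this, of "Suc m" k] show "real (level_cost n k s) \<le> 768 * real n * (1 / max 1 (x - real s))"
      using s n unfolding x_def by simp
  qed
  also have "\<dots> = 768 * real n * (\<Sum>s\<in>{1..Suc m}. 1 / max 1 (x - real s))" by (simp only: sum_distrib_left)
  also have "(\<Sum>s\<in>{1..Suc m}. 1 / max 1 (x - real s)) \<le> 3 * log 2 x + log 2 x"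
  proof -
    have "(\<Sum>s\<in>{1..Suc m}. 1 / max 1 (x - real s)) =
        (\<Sum>s\<in>{1..S}. 1 / max 1 (x - real s)) + 1 / max 1 (x - real (Suc S)) + 1 / max 1 (x - real (Suc (Suc S)))"
      unfolding S by simp
    also have "\<dots> \<le> (\<Sum>s\<in>{1..S}. 1 / max 1 (x - real s)) + 1 + 1"
      by (intro add_mono) auto
    also have "(\<Sum>s\<in>{1..S}. 1 / max 1 (x - real s)) \<le> 1 / (x - real S) + ln (x / (x - real S))"
      using m(3) S by (intro sum_reciprocal_le_ln) auto
    also have "\<dots> \<le> 1 + ln x"
    proof (rule add_mono)
      show "1 / (x - real S) \<le> 1" using m(3) S by simp
      have "x / (x - real S) \<le> x / 1" using m(3) S x by (intro divide_left_mono) auto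
      then show "ln (x / (x - real S)) \<le> ln x" using m(3) S x by (intro ln_mono) auto
    qed
    also have "1 + ln x \<le> 1 + log 2 x" using ln_le_log2[of x] x by simp
    finally show ?thesis using lx by linarith
  qed
  finally have lev: "(\<Sum>s\<in>{1..Suc m}. real (level_cost n k s)) \<le> 3072 * (real n * log 2 x)"
    by (simp add: mult_left_mono)
  have "real (detect_cost 2 n) \<le> 32 * real n / x" unfolding x_def using n by (intro detect_cost_2_le) auto
  also have "\<dots> \<le> 32 * real n / 1" using x by (intro divide_left_mono) auto
  finally have det: "real (detect_cost 2 n) \<le> 32 * real n" by simp
  have nl: "real n \<le> real n * log 2 x" using lx n by simp
  have "real (total_cost n k (Suc m)) + 1 = real k + real (detect_cost 2 n) + (\<Sum>s\<in>{1..Suc m}. real (level_cost n k s)) + 1"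
    unfolding total_cost_def by simp
  also have "\<dots> \<le> 4000 * (real n * log 2 x + real k)"
  proof -
    have add: "r + d + l + 1 \<le> 4000 * (p + r)"
      if "d \<le> 32 * q" "l \<le> 3072 * p" "q \<le> p" "1 \<le> q" "0 \<le> r" for d l p q r :: real
      using that by simp
    show ?thesis by (rule add[OF det lev nl]) (use n in auto)
  qed
  finally show ?thesis using m(2) unfolding x_def by blast
qed

lemma total_cost_few_colors:
  assumes k: "k \<ge> 2" and kn: "2 * k \<le> n"
  shows "\<exists>t. n < 2 ^ t \<and>
    real (total_cost n k t) + 1 \<le> 40000 * (real n * log 2 (log 2 (real n) / log 2 (real n / real k)))"
proof -
  define x where "x = log 2 (real n)"
  define a where "a = log 2 (real n / real k)"
  have n: "n \<ge> 4" using k kn by simp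
  obtain m where m: "2 ^ m \<le> n" "n < 2 ^ Suc m" "real m \<le> x" "x < real m + 1"
    unfolding x_def by (rule exists_binary_length[of n]) (use n in auto)
  obtain S where S: "2 ^ S \<le> k" "k < 2 ^ Suc S" "real S \<le> log 2 (real k)"
    by (rule exists_binary_length[of k]) (use k in auto)
  have xa: "x = a + log 2 (real k)" unfolding x_def a_def using n k by (simp add: log_divide)
  have k1: "log 2 (real k) \<ge> 1" using k by simp
  have "real (2 * k) \<le> real n" using kn by (simp only: of_nat_le_iff)
  then have a1: "a \<ge> 1" unfolding a_def using k by (subst le_log_iff) (auto simp: field_simps)
  have aS: "a \<le> x - real S" using xa S(3) by simp
  have Sx: "real S < x" using aS a1 by linarith
  define \<Phi> where "\<Phi> = log 2 (x / a)"
  have ln\<Phi>: "ln (x / a) \<le> \<Phi>" unfolding \<Phi>_def using xa a1 k1 by (intro ln_le_log2) (simp add: field_simps)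
  \<comment> \<open>All costs outside the logarithm are O(n / a) and have to be absorbed by
    \<open>\<Phi>\<close>, which is itself small for small \<open>k\<close>. Two colours give x
    \<ge> a + 1, so \<open>\<Phi>\<close> is at least 1 - a/x \<ge> 1 / (a + 1).\<close>
  have inv: "1 / a \<le> 2 * \<Phi>"
  proof -
    have "ln (a / x) \<le> a / x - 1" using a1 xa k1 by (intro ln_le_minus_one) auto
    then have "1 - a / x \<le> ln (x / a)" using a1 xa k1 by (simp add: ln_div)
    moreover have "1 / (2 * a) \<le> 1 - a / x"
    proof -
      have "a / x \<le> a / (a + 1)" using xa k1 a1 by (intro divide_left_mono mult_pos_pos) auto
      also have "1 - a / (a + 1) = 1 / (a + 1)" using a1 by (simp add: field_simps)
      moreover have "1 / (2 * a) \<le> 1 / (a + 1)" using a1 by (intro divide_left_mono) auto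
      ultimately show ?thesis by linarith
    qed
    ultimately show ?thesis using ln\<Phi> by simp
  qed
  have "(\<Sum>s\<in>{1..Suc m}. real (level_cost n k s)) \<le>
      (\<Sum>s\<in>{1..Suc m}. 768 * real n * ((3/4) ^ (s - Suc S) / max 1 (x - real s)))"
  proof (rule sum_mono)
    fix s assume s: "s \<in> {1..Suc m}"
    then have "(2::nat) ^ s \<le> 2 ^ Suc m" by (intro power_increasing) auto
    then have "2 ^ s \<le> 2 * n" using m(1) by simp
    then show "real (level_cost n k s) \<le> 768 * real n * ((3/4) ^ (s - Suc S) / max 1 (x - real s))"
      unfolding x_def using n S(2) by (intro level_cost_le) auto
  qed
  also have "\<dots> = 768 * real n * (\<Sum>s\<in>{1..Suc m}. (3/4) ^ (s - Suc S) / max 1 (x - real s))"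
    by (simp only: sum_distrib_left)
  also have "\<dots> \<le> 768 * real n * (21 / (x - real S) + ln (x / (x - real S)))"
    by (intro mult_left_mono sum_damped_reciprocal_le Sx) auto
  also have "\<dots> \<le> 768 * real n * (21 / a + ln (x / a))"
  proof -
    have "21 / (x - real S) \<le> 21 / a" using aS a1 by (intro divide_left_mono mult_pos_pos) auto
    moreover have "x / (x - real S) \<le> x / a" using aS a1 Sx by (intro divide_left_mono mult_pos_pos) auto
    then have "ln (x / (x - real S)) \<le> ln (x / a)" using aS a1 Sx by (subst ln_le_cancel_iff) (auto intro!: divide_pos_pos)
    ultimately show ?thesis by (intro mult_left_mono add_mono) auto
  qed
  also have "\<dots> \<le> 768 * real n * (42 * \<Phi> + \<Phi>)"
    using inv ln\<Phi> by (intro mult_left_mono add_mono) auto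
  finally have lev: "(\<Sum>s\<in>{1..Suc m}. real (level_cost n k s)) \<le> 33024 * (real n * \<Phi>)" by simp
  have na: "real n / a \<le> 2 * (real n * \<Phi>)"
    using mult_left_mono[OF inv, of "real n"] by simp
  have "real (detect_cost 2 n) \<le> 32 * real n / x" unfolding x_def using n by (intro detect_cost_2_le) auto
  also have "\<dots> \<le> 32 * real n / a" using xa a1 k1 by (intro divide_left_mono mult_pos_pos) auto
  finally have det: "real (detect_cost 2 n) \<le> 64 * (real n * \<Phi>)" using na by simp
  have log_le: "log 2 y \<le> 2 * y" if "y > 0" for y :: real
  proof -
    have "y * 1 \<le> y * (2 * ln 2)" using ln2_ge_two_thirds that by (intro mult_left_mono) auto
    then show ?thesis using ln_bound[OF that] by (simp add: log_def field_simps)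
  qed
  \<comment> \<open>Applying log y \<le> 2y to y = n/k makes the \<open>k\<close> monochromatic
    guesses O(n / a) as well.\<close>
  have "real k * a \<le> real k * (2 * (real n / real k))" unfolding a_def using n k by (intro mult_left_mono log_le) auto
  then have "real k \<le> 2 * (real n / a)" using a1 k by (simp add: field_simps)
  then have kk: "real k \<le> 4 * (real n * \<Phi>)" using na by linarith
  then have one: "1 \<le> 4 * (real n * \<Phi>)" using k by simp
  have "real (total_cost n k (Suc m)) + 1 = real k + real (detect_cost 2 n) + (\<Sum>s\<in>{1..Suc m}. real (level_cost n k s)) + 1"
    unfolding total_cost_def by simp
  also have "\<dots> \<le> 40000 * (real n * \<Phi>)"
    using kk det lev one by linarith
  finally show ?thesis using m(2) unfolding x_def a_def \<Phi>_def by blast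
qed

text \<open>Both constants are fixed before \<open>k\<close> and are thus absolute; only the
  threshold for \<open>n\<close> depends on \<open>k\<close>. Part (ii) asks for two colours because
  with one colour the logarithm vanishes although one guess is always made.\<close>

theorem theorem1:
  "(\<exists>C>0. \<forall>k :: nat \<Rightarrow> nat.
      (\<lambda>n. real (k n)) \<in> \<Omega>(\<lambda>n. real n) \<longrightarrow>
      (\<forall>\<^sub>F n in sequentially.
         \<exists>M. randomized_strategy n (k n) M \<and>
             (\<forall>z\<in>codes n (k n). expected_guesses n M z
                \<le> ennreal (C * (real n * log 2 (log 2 (real n)) + real (k n))))))
   \<and>
   (\<exists>C>0. \<forall>k :: nat \<Rightarrow> nat.
      (\<lambda>n. real (k n)) \<in> o(\<lambda>n. real n) \<longrightarrow>
      (\<forall>\<^sub>F n in sequentially. k n \<ge> 2) \<longrightarrow>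
      (\<forall>\<^sub>F n in sequentially.
         \<exists>M. randomized_strategy n (k n) M \<and>
             (\<forall>z\<in>codes n (k n). expected_guesses n M z
                \<le> ennreal (C * (real n * log 2 (log 2 (real n) / log 2 (real n / real (k n))))))))"
proof (intro conjI)
  have strategy: "\<exists>M. randomized_strategy n k M \<and> (\<forall>z\<in>codes n k. expected_guesses n M z \<le> ennreal c)"
    if "k \<ge> 2" "n > 0" "n < 2 ^ t" "real (total_cost n k t) + 1 \<le> c" for n k t c
    using that by (intro expected_guesses_determines[OF determines_code] codes_nonempty) auto
  show "\<exists>C>0. \<forall>k :: nat \<Rightarrow> nat. (\<lambda>n. real (k n)) \<in> \<Omega>(\<lambda>n. real n) \<longrightarrow>
      (\<forall>\<^sub>F n in sequentially. \<exists>M. randomized_strategy n (k n) M \<and>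
             (\<forall>z\<in>codes n (k n). expected_guesses n M z
                \<le> ennreal (C * (real n * log 2 (log 2 (real n)) + real (k n)))))"
  proof (intro exI[of _ 4000] conjI allI impI)
    fix k :: "nat \<Rightarrow> nat" assume "(\<lambda>n. real (k n)) \<in> \<Omega>(\<lambda>n. real n)"
    then obtain c where c: "c > 0" "\<forall>\<^sub>F n in sequentially. norm (real (k n)) \<ge> c * norm (real n)"
      by (rule landau_omega.bigE)
    \<comment> \<open>The threshold 2/c provides the colours 1 and 2 used in the search for the
      blank.\<close>
    from c(2) eventually_ge_at_top[of 4] eventually_ge_at_top[of "nat \<lceil>2 / c\<rceil>"]
    show "\<forall>\<^sub>F n in sequentially. \<exists>M. randomized_strategy n (k n) M \<and>
             (\<forall>z\<in>codes n (k n). expected_guesses n M z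
                \<le> ennreal (4000 * (real n * log 2 (log 2 (real n)) + real (k n))))"
    proof eventually_elim
      case (elim n)
      have "2 / c \<le> real n" using elim(3) by linarith
      then have "2 \<le> c * real n" using c(1) by (simp add: field_simps)
      then have "2 \<le> real (k n)" using elim(1) by simp
      then have "k n \<ge> 2" by simp
      moreover obtain t where "n < 2 ^ t"
        "real (total_cost n (k n) t) + 1 \<le> 4000 * (real n * log 2 (log 2 (real n)) + real (k n))"
        using total_cost_many_colors[OF elim(2)] by blast
      ultimately show ?case using elim(2) by (intro strategy[of "k n" n t]) auto
    qed
  qed simp
  show "\<exists>C>0. \<forall>k :: nat \<Rightarrow> nat. (\<lambda>n. real (k n)) \<in> o(\<lambda>n. real n) \<longrightarrow>
      (\<forall>\<^sub>F n in sequentially. k n \<ge> 2) \<longrightarrow>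
      (\<forall>\<^sub>F n in sequentially. \<exists>M. randomized_strategy n (k n) M \<and>
             (\<forall>z\<in>codes n (k n). expected_guesses n M z
                \<le> ennreal (C * (real n * log 2 (log 2 (real n) / log 2 (real n / real (k n)))))))"
  proof (intro exI[of _ 40000] conjI allI impI)
    fix k :: "nat \<Rightarrow> nat"
    assume "(\<lambda>n. real (k n)) \<in> o(\<lambda>n. real n)" and k2: "\<forall>\<^sub>F n in sequentially. k n \<ge> 2"
    \<comment> \<open>The factor 1/2 yields log (n/k) \<ge> 1.\<close>
    then have "\<forall>\<^sub>F n in sequentially. norm (real (k n)) \<le> 1 / 2 * norm (real n)"
      by (intro landau_o.smallD) auto
    from this k2
    show "\<forall>\<^sub>F n in sequentially. \<exists>M. randomized_strategy n (k n) M \<and>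
             (\<forall>z\<in>codes n (k n). expected_guesses n M z
                \<le> ennreal (40000 * (real n * log 2 (log 2 (real n) / log 2 (real n / real (k n))))))"
    proof eventually_elim
      case (elim n)
      have "real (2 * k n) \<le> real n" using elim(1) by simp
      then have kn: "2 * k n \<le> n" by (simp only: of_nat_le_iff)
      obtain t where "n < 2 ^ t" "real (total_cost n (k n) t) + 1 \<le>
          40000 * (real n * log 2 (log 2 (real n) / log 2 (real n / real (k n))))"
        using total_cost_few_colors[OF elim(2) kn] by blast
      then show ?case using elim(2) kn by (intro strategy[of "k n" n t]) auto
    qed
  qed simp
qed

end
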